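(* Fix $d\ge1$. Let $N_i$ denote the $i$-th smallest prime number. For each $i$, let $a_i\in\{1,\dots,N_i-1\}$ be a maximizer over $a\in\{1,\dots,N_i-1\}$ of the product $\lambda_1(\Lambda_{N_i,a})\,\lambda_1(\Lambda_{N_i,a}^{\perp})$, where $\Lambda_{N,a}$ is the lattice of the Korobov lattice point set with $N$ points and parameter $a$. Then the family of Korobov lattice point sets $(P_{N_i,z(a_i)})_{i\in\mathbb{N}}$ with $z(a)=(1,a,a^2,\dots,a^{d-1}) \bmod N_i$ is a quasi-uniform family of point sets over $[0,1]^d$.
   Context: For $N\in\mathbb{N}$ and $z\in\mathbb{Z}^d$ with $\gcd(N,z_1,\dots,z_d)=1$, the rank-1 lattice point set is $P_{N,z}=\{(\{nz_1/N\},\dots,\{nz_d/N\}) : n=0,\dots,N-1\}$, $\{x\}=x-\lfloor x\rfloor$; it equals $\Lambda\cap[0,1)^d$ for $\Lambda=\frac1N z\mathbb{Z}+\mathbb{Z}^d$. The Korobov lattice point set with parameter $a$ uses $z=(1,a,\dots,a^{d-1}) \bmod N$, and $\Lambda_{N,a}=\frac1N z\mathbb{Z}+\mathbb{Z}^d$. The dual lattice is $\Lambda^{\perp}=\{y\in\mathbb{R}^d : x\cdot y\in\mathbb{Z}\ \forall x\in\Lambda\}$; $\lambda_1(\cdot)$ denotes the Euclidean length of a shortest non-zero lattice vector. For a finite point set $P\subset[0,1]^d$ with at least two points: $h(P)=\sup_{x\in[0,1]^d}\min_{y\in P}\|x-y\|_2$, $q(P)=\frac12\min_{x\ne y\in P}\|x-y\|_2$,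 $\rho(P)=h(P)/q(P)$. A family $(P_{N_i})_{i}$ with $N_i=|P_{N_i}|$ is a quasi-uniform family if there is $c>1$ with $N_i<N_{i+1}\le cN_i$ for all $i$ and a constant $C_d$ independent of $i$ with $\rho(P_{N_i})\le C_d$ for all $i$. *)

theory Defs
  imports "HOL-Analysis.Analysis" "HOL-Computational_Algebra.Primes" "HOL-Library.Infinite_Set"
begin

text \<open>Vectors in R^d are represented as functions nat => real that vanish outside {0..<d}.\<close>

definition vec_space :: "nat \<Rightarrow> (nat \<Rightarrow> real) set" where
  "vec_space d = {x. \<forall>j\<ge>d. x j = 0}"

definition vnorm :: "nat \<Rightarrow> (nat \<Rightarrow> real) \<Rightarrow> real" where
  "vnorm d x = sqrt (\<Sum>j<d. (x j)^2)"

definition vdist :: "nat \<Rightarrow> (nat \<Rightarrow> real) \<Rightarrow> (nat \<Rightarrow> real) \<Rightarrow> real" where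
  "vdist d x y = vnorm d (\<lambda>j. x j - y j)"

definition unit_cube :: "nat \<Rightarrow> (nat \<Rightarrow> real) set" where
  "unit_cube d = {x \<in> vec_space d. \<forall>j<d. 0 \<le> x j \<and> x j \<le> 1}"

definition korobov_z :: "nat \<Rightarrow> nat \<Rightarrow> nat \<Rightarrow> int" where
  "korobov_z N a j = int (a ^ j mod N)"

definition rank1_pts :: "nat \<Rightarrow> nat \<Rightarrow> (nat \<Rightarrow> int) \<Rightarrow> (nat \<Rightarrow> real) set" where
  "rank1_pts d N z = {x \<in> vec_space d. \<exists>n<N. \<forall>j<d. x j = frac (real n * of_int (z j) / real N)}"

definition rank1_lattice :: "nat \<Rightarrow> nat \<Rightarrow> (nat \<Rightarrow> int) \<Rightarrow> (nat \<Rightarrow> real) set" where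
  "rank1_lattice d N z = {x \<in> vec_space d. \<exists>n::int. \<exists>k::nat \<Rightarrow> int.
      \<forall>j<d. x j = of_int n * of_int (z j) / real N + of_int (k j)}"

definition dual_lattice :: "nat \<Rightarrow> (nat \<Rightarrow> real) set \<Rightarrow> (nat \<Rightarrow> real) set" where
  "dual_lattice d L = {y \<in> vec_space d. \<forall>x\<in>L. (\<Sum>j<d. x j * y j) \<in> \<int>}"

definition lambda1 :: "nat \<Rightarrow> (nat \<Rightarrow> real) set \<Rightarrow> real" where
  "lambda1 d L = Inf {vnorm d x | x. x \<in> L \<and> x \<noteq> (\<lambda>_. 0)}"

definition fill_dist :: "nat \<Rightarrow> (nat \<Rightarrow> real) set \<Rightarrow> real" where
  "fill_dist d P = (SUP x\<in>unit_cube d. INF y\<in>P. vdist d x y)"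

definition sep_radius :: "nat \<Rightarrow> (nat \<Rightarrow> real) set \<Rightarrow> real" where
  "sep_radius d P = Inf {vdist d x y | x y. x \<in> P \<and> y \<in> P \<and> x \<noteq> y} / 2"

definition mesh_ratio :: "nat \<Rightarrow> (nat \<Rightarrow> real) set \<Rightarrow> real" where
  "mesh_ratio d P = fill_dist d P / sep_radius d P"

definition quasi_uniform :: "nat \<Rightarrow> (nat \<Rightarrow> (nat \<Rightarrow> real) set) \<Rightarrow> bool" where
  "quasi_uniform d Ps \<longleftrightarrow>
     (\<forall>i. finite (Ps i) \<and> Ps i \<subseteq> unit_cube d \<and> 2 \<le> card (Ps i)) \<and>
     (\<exists>c::real. c > 1 \<and> (\<forall>i. card (Ps i) < card (Ps (Suc i)) \<and>
                              real (card (Ps (Suc i))) \<le> c * real (card (Ps i)))) \<and>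
     (\<exists>C::real. \<forall>i. mesh_ratio d (Ps i) \<le> C)"

text \<open>The i-th smallest prime (i = 0 gives 2).\<close>
definition nth_prime :: "nat \<Rightarrow> nat" where
  "nth_prime i = Infinite_Set.enumerate {p::nat. prime p} i"

end

theory Submission
  imports Defs "HOL-Computational_Algebra.Polynomial"
begin

text \<open>Write \<open>A = \<lambda>\<^sub>1(\<Lambda>)\<close> and \<open>B = \<lambda>\<^sub>1(\<Lambda>\<^sup>\<bottom>)\<close>. The separation radius is at least \<open>A / 2\<close>, and a
  Fourier argument bounds the fill distance by \<open>O\<^sub>d(1 / B)\<close>, so the mesh ratio is \<open>O\<^sub>d(1 / (A B))\<close>. As
  the parameters maximise \<open>A B\<close>, it suffices that for each prime \<open>N\<close> some parameter makes \<open>A B\<close>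
  bounded below. A nonzero \<open>h\<close> is dual for at most \<open>d - 1\<close> parameters (the roots of a polynomial modulo
  \<open>N\<close>), so by a union bound some parameter has no dual vector much shorter than \<open>N\<^sup>1\<^sup>/\<^sup>d\<close>; a pigeonhole
  argument turns this into a lower bound of order \<open>N\<^sup>-\<^sup>1\<^sup>/\<^sup>d\<close> for \<open>A\<close>. The gaps between primes are controlled by a
  weak form of Bertrand's postulate.\<close>

section \<open>Primes between powers of two\<close>

lemma prod_primes_dvd:
  fixes n :: nat
  assumes "finite A" "\<And>p. p \<in> A \<Longrightarrow> prime p" "\<And>p. p \<in> A \<Longrightarrow> p dvd n"
  shows "\<Prod>A dvd n"
  using assms
proof (induction A rule: finite_induct)
  case (insert p A)
  have "coprime p (\<Prod>A)"
    by (rule prod_coprime_right) (use insert in \<open>metis insertI1 insertI2 primes_coprime\<close>)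
  moreover have "p dvd n" "\<Prod>A dvd n" using insert by auto
  ultimately show ?case using insert.hyps by (simp add: divides_mult)
qed simp

definition prime_count :: "nat \<Rightarrow> nat" where
  "prime_count n = card {p. prime p \<and> p \<le> n}"

text \<open>With \<open>n = 2 ^ i\<close>, a prime in \<open>(n, 2n]\<close> divides
  \<open>fact (2n)\<close> but not \<open>fact n\<close>, hence divides the central binomial
  coefficient, which is at most \<open>4 ^ n\<close>. Each such prime exceeds \<open>2 ^ i\<close>;
  comparing exponents of 2 bounds their number.\<close>

lemma card_primes_dyadic: "i * card {p::nat. prime p \<and> 2 ^ i < p \<and> p \<le> 2 ^ Suc i} \<le> (2 ^ Suc i :: nat)"
proof -
  define A where "A = {p::nat. prime p \<and> 2 ^ i < p \<and> p \<le> 2 ^ Suc i}"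
  define n :: nat where "n = 2 ^ i"
  have fin: "finite A" by (rule finite_subset[of _ "{..2 ^ Suc i}"]) (auto simp: A_def)
  have "p dvd (2 * n) choose n" if p: "p \<in> A" for p
  proof -
    have pp: "prime p" "n < p" "p \<le> 2 * n" using p by (auto simp: A_def n_def)
    have "(fact (2*n) :: nat) = fact n * fact n * ((2 * n) choose n)"
      using binomial_fact_lemma[of n "2 * n"] by (simp add: mult_2)
    moreover have "p dvd fact (2*n)" using pp by (simp add: prime_dvd_fact_iff)
    moreover have "\<not> p dvd fact n" using pp by (simp add: prime_dvd_fact_iff)
    ultimately show ?thesis using pp(1) by (metis prime_dvd_mult_iff)
  qed
  hence "\<Prod>A dvd (2 * n) choose n"
    by (intro prod_primes_dvd fin) (auto simp: A_def)
  hence le: "\<Prod>A \<le> (2 * n) choose n" by (intro dvd_imp_le) (simp_all add: zero_less_binomial)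
  have "(2 ^ i) ^ card A \<le> (\<Prod>p\<in>A. p)"
    using prod_mono[of A "\<lambda>_. 2 ^ i" "\<lambda>p. p"] by (auto simp: A_def less_imp_le)
  also note le
  also have "(2 * n) choose n \<le> (\<Sum>k\<le>2*n. (2 * n) choose k)"
    by (rule member_le_sum) auto
  also have "\<dots> = 2 ^ (2 * n)" by (simp add: choose_row_sum)
  finally have "(2::nat) ^ (i * card A) \<le> 2 ^ (2 * n)" by (simp add: power_mult)
  hence "i * card A \<le> 2 * n" by simp
  thus ?thesis by (simp add: A_def n_def)
qed

lemma prime_count_split:
  "m \<le> n \<Longrightarrow> prime_count n = prime_count m + card {p. prime p \<and> m < p \<and> p \<le> n}"
proof -
  assume "m \<le> n"
  hence "{p. prime p \<and> p \<le> n} = {p. prime p \<and> p \<le> m} \<union> {p. prime p \<and> m < p \<and> p \<le> n}"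
    by auto
  moreover have "finite {p. prime p \<and> p \<le> m}" "finite {p. prime p \<and> m < p \<and> p \<le> n}"
    by auto
  ultimately show ?thesis unfolding prime_count_def
    by (simp only:) (rule card_Un_disjoint; auto)
qed

text \<open>Chebyshev's upper bound at powers of two, by adding up the dyadic counts. The constant 6
  survives the induction because \<open>6 + 2 = 8\<close> and
  \<open>8 * (k + 1) \<le> 12 * k\<close> once \<open>k \<ge> 2\<close>.\<close>

lemma prime_count_power_two: "k * prime_count (2 ^ k) \<le> 6 * 2 ^ k"
proof (induction k)
  case (Suc k)
  define u where "u = card {p. prime p \<and> 2 ^ k < p \<and> p \<le> (2 ^ Suc k :: nat)}"
  have u: "k * u \<le> 2 ^ Suc k" unfolding u_def by (rule card_primes_dyadic)
  have eq: "prime_count (2 ^ Suc k) = prime_count (2 ^ k) + u"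
    unfolding u_def by (rule prime_count_split) simp
  show ?case
  \<comment> \<open>For \<open>k \<le> 1\<close> that inequality fails, and the trivial count of all
    positive integers suffices.\<close>
  proof (cases "k \<le> 1")
    case True
    have "prime_count n \<le> n" for n
    proof -
      have "{p. prime p \<and> p \<le> n} \<subseteq> {1..n}" by (auto dest: prime_ge_1_nat)
      from card_mono[OF _ this] show ?thesis by (simp add: prime_count_def)
    qed
    from this[of 2] this[of 4] True show ?thesis
      by (cases "k = 0") (simp_all add: le_Suc_eq)
  next
    case False
    have "k * (Suc k * prime_count (2 ^ Suc k)) = Suc k * (k * prime_count (2 ^ k) + k * u)"
      unfolding eq by (simp add: algebra_simps)
    also have "\<dots> \<le> Suc k * (8 * 2 ^ k)"
      using u Suc.IH by (intro mult_left_mono) auto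
    also have "\<dots> = (8 * Suc k) * 2 ^ k" by (simp only: mult_ac)
    also have "\<dots> \<le> (12 * k) * 2 ^ k" using False by (intro mult_right_mono) auto
    also have "\<dots> = k * (6 * 2 ^ Suc k)" by simp
    finally show ?thesis using False by simp
  qed
qed simp

text \<open>Induction along Leibniz' harmonic triangle: with \<open>l n k = 1 / (n * ((n - 1) choose k))\<close> one has
  \<open>l n k + l n (k + 1) = l (n - 1) k\<close>.\<close>

lemma choose_dvd_common_multiple:
  assumes "k < n" "\<And>j. j \<in> {1..n} \<Longrightarrow> j dvd L"
  shows "n * ((n - 1) choose k) dvd (L::nat)"
  using assms
proof (induction k arbitrary: n)
  case (Suc k)
  define a where "a = n * ((n - 1) choose k)"
  define b where "b = n * ((n - 1) choose Suc k)"
  define c where "c = (n - 1) * ((n - 2) choose k)"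
  obtain m where n: "n = Suc (Suc m)" and km: "k \<le> m"
    using Suc.prems(1) by (metis Suc_less_eq2 less_Suc_eq_le less_imp_Suc_add not0_implies_Suc not_less0)
  have a: "a dvd L" unfolding a_def using Suc by simp
  have c: "c dvd L" unfolding c_def using Suc.IH[of "n-1"] Suc.prems n km by (simp add: numeral_2_eq_2)
  have pos: "a > 0" "b > 0" "c > 0" using n km Suc.prems(1)
    by (auto simp: a_def b_def c_def)
  have e0: "((n - 1) choose k) + ((n - 1) choose Suc k) = n choose Suc k"
    using n by simp
  have e1: "Suc k * (n choose Suc k) = n * ((n - 1) choose k)"
    using n Suc_times_binomial_eq[of "Suc m" k] by (simp del: binomial_Suc_Suc mult_Suc add: mult.commute)
  have e2: "Suc k * ((n - 1) choose Suc k) = (n - 1) * ((n - 2) choose k)"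
    using n Suc_times_binomial_eq[of m k] by (simp del: binomial_Suc_Suc mult_Suc add: mult.commute)
  \<comment> \<open>This is \<open>1 / a + 1 / b = 1 / c\<close>, cleared of denominators.\<close>
  have key: "c * (a + b) = a * b"
  proof -
    have "c * (a + b) = Suc k * ((n - 1) choose Suc k) * (n * (n choose Suc k))"
      unfolding a_def b_def c_def e2[symmetric] e0[symmetric] by (simp add: algebra_simps)
    also have "\<dots> = b * (Suc k * (n choose Suc k))" unfolding b_def by (simp add: algebra_simps)
    also have "\<dots> = a * b" unfolding e1 a_def by simp
    finally show ?thesis .
  qed
  obtain x y where x: "L = a * x" and y: "L = c * y" using a c by blast
  \<comment> \<open>Here \<open>L / b = L / c - L / a\<close> is a difference of integers.\<close>
  have "b * (y - x) = L"
  proof -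
    have "a * b * y = c * (a + b) * y" by (simp add: key)
    also have "\<dots> = (a + b) * L" by (simp add: y)
    also have "\<dots> = a * (L + b * x)" by (subst (1) add_mult_distrib) (use x in \<open>simp add: algebra_simps\<close>)
    finally have "b * y = L + b * x" using pos by simp
    thus ?thesis by (simp add: diff_mult_distrib2)
  qed
  thus ?case unfolding b_def by (metis dvd_triv_left)
qed auto

text \<open>The witness is the least common multiple of 1, ..., \<open>M\<close>: the product over
  the primes of their largest powers not exceeding \<open>M\<close>. It has
  \<open>prime_count M\<close> factors, each at most \<open>M\<close>.\<close>

lemma common_multiple_le_power_prime_count:
  assumes "M > 0"
  shows "\<exists>L>0. L \<le> M ^ prime_count M \<and> (\<forall>j\<in>{1..M}. j dvd (L::nat))"
proof -
  define P where "P = {p::nat. prime p \<and> p \<le> M}"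
  define e where "e = (\<lambda>p::nat. GREATEST i. p ^ i \<le> M)"
  define L where "L = (\<Prod>p\<in>P. p ^ e p)"
  have finP: "finite P" by (simp add: P_def)
  \<comment> \<open>Bounded exponents make the \<open>GREATEST\<close> in \<open>e\<close> a genuine
    maximum.\<close>
  have bound: "i \<le> M" if "p ^ i \<le> M" "prime p" for p i :: nat
  proof -
    have "i < 2 ^ i" by simp
    also have "(2::nat) ^ i \<le> p ^ i" using that by (intro power_mono) (auto dest: prime_ge_2_nat)
    finally show ?thesis using that by simp
  qed
  have e1: "p ^ e p \<le> M" if "prime p" for p
    unfolding e_def by (rule GreatestI_nat[of _ 0 M]) (use assms bound that in auto)
  have e2: "i \<le> e p" if "prime p" "p ^ i \<le> M" for p i
    unfolding e_def by (rule Greatest_le_nat[of _ _ M]) (use bound that in auto)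
  have Lpos: "L > 0" unfolding L_def P_def by (auto intro!: prod_pos dest: prime_gt_0_nat)
  have "L \<le> (\<Prod>p\<in>P. M)" unfolding L_def by (rule prod_mono) (use e1 in \<open>auto simp: P_def\<close>)
  hence "L \<le> M ^ prime_count M" by (simp add: prime_count_def P_def)
  moreover have "j dvd L" if j: "j \<in> {1..M}" for j
  proof (rule multiplicity_le_imp_dvd)
    show "j \<noteq> 0" using j by auto
    fix p :: nat assume p: "prime p"
    have "p ^ multiplicity p j \<le> j" using j by (intro dvd_imp_le multiplicity_dvd) auto
    hence le: "p ^ multiplicity p j \<le> M" using j by auto
    show "multiplicity p j \<le> multiplicity p L"
    proof (cases "p \<in> P")
      case True
      have "multiplicity p L = e p" unfolding L_def
        by (subst multiplicity_prod_prime_powers) (use True p finP in \<open>auto simp: P_def\<close>)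
      thus ?thesis using e2[OF p le] by simp
    next
      case False
      hence "p > M" using p by (simp add: P_def)
      hence "\<not> p dvd j" using j by (auto dest: dvd_imp_le)
      thus ?thesis by (simp add: not_dvd_imp_multiplicity_0)
    qed
  qed
  ultimately show ?thesis using Lpos by blast
qed

text \<open>Each \<open>M * ((M - 1) choose j)\<close> divides the common multiple \<open>L\<close>,
  so is at most \<open>L\<close>; these \<open>M\<close> numbers add up to
  \<open>M * 2 ^ (M - 1)\<close>.\<close>

lemma le_prime_count:
  assumes "M > 0"
  shows "2 ^ (M - 1) \<le> M ^ prime_count M"
proof -
  obtain L where L: "L > 0" "L \<le> M ^ prime_count M" "\<forall>j\<in>{1..M}. j dvd (L::nat)"
    using common_multiple_le_power_prime_count[OF assms] by blast
  have le: "M * ((M - 1) choose j) \<le> L" if "j < M" for j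
    using choose_dvd_common_multiple[OF that, of L] L by (intro dvd_imp_le) auto
  have "M * 2 ^ (M - 1) = (\<Sum>j\<le>M - 1. M * ((M - 1) choose j))"
    by (simp add: choose_row_sum flip: sum_distrib_left)
  also have "\<dots> \<le> (\<Sum>j\<le>M - 1. L)" by (rule sum_mono) (use le assms in auto)
  also have "\<dots> = M * L" using assms by simp
  finally have "2 ^ (M - 1) \<le> L" using assms by simp
  with L show ?thesis by linarith
qed

text \<open>Without such a prime, the same count \<open>q\<close> belongs to \<open>2 ^ k\<close>
  and \<open>2 ^ (k + 6)\<close>. The lower bound at the larger power needs
  \<open>(k + 6) * q\<close> to be about \<open>64 * 2 ^ k\<close>, the upper bound at the smaller
  one allows only \<open>k * q \<le> 6 * 2 ^ k\<close>; the exponent 6 leaves room for the factor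
  \<open>(k + 6) / k \<le> 7\<close>.\<close>

lemma prime_between_powers_two: "\<exists>p. prime p \<and> 2 ^ k < p \<and> p \<le> (2 ^ (k + 6) :: nat)"
proof (rule ccontr)
  assume neg: "\<not> ?thesis"
  define q where "q = prime_count (2 ^ k)"
  have "{p. prime p \<and> 2 ^ k < p \<and> p \<le> (2 ^ (k + 6) :: nat)} = {}" using neg by blast
  hence q: "prime_count (2 ^ (k + 6)) = q"
    using prime_count_split[of "2 ^ k" "2 ^ (k + 6)"] by (simp add: q_def power_add del: Collect_empty_eq)
  have "2 ^ (2 ^ (k + 6) - 1) \<le> ((2 ^ (k + 6)) ^ q :: nat)"
    using le_prime_count[of "2 ^ (k + 6)"] unfolding q by simp
  hence "(2::nat) ^ (2 ^ (k + 6) - 1) \<le> 2 ^ ((k + 6) * q)" by (metis power_mult)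
  hence "2 ^ (k + 6) - 1 \<le> (k + 6) * q" by (subst (asm) power_increasing_iff) auto
  hence le: "64 * 2 ^ k \<le> (k + 6) * q + 1" by (simp add: power_add)
  have qk: "k * q \<le> 6 * 2 ^ k" unfolding q_def by (rule prime_count_power_two)
  show False
  \<comment> \<open>The upper bound is void at \<open>k = 0\<close>, but there is no prime up to
    1.\<close>
  proof (cases "k = 0")
    case True
    have "{p::nat. prime p \<and> p \<le> 1} = {}" by (auto dest: prime_gt_1_nat)
    hence "q = 0" using True by (simp add: q_def prime_count_def del: Collect_empty_eq)
    with le True show ?thesis by simp
  next
    case False
    have "k * (64 * 2 ^ k) \<le> k * ((k + 6) * q + 1)" using le by (rule mult_left_mono) simp
    also have "\<dots> = (k + 6) * (k * q) + k" by (simp add: algebra_simps)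
    also have "\<dots> \<le> (k + 6) * (6 * 2 ^ k) + k" using qk by (intro add_right_mono mult_left_mono) auto
    finally have "58 * (k * 2 ^ k) \<le> 36 * 2 ^ k + k" by (simp add: algebra_simps)
    moreover have "k \<le> k * 2 ^ k" by simp
    moreover have "1 * 2 ^ k \<le> k * (2 ^ k :: nat)" using False by (intro mult_right_mono) auto
    moreover have "(2::nat) ^ k > 0" by simp
    ultimately show False by linarith
  qed
qed

section \<open>Parameters without short dual vectors\<close>

text \<open>Lagrange's bound over the field with \<open>N\<close> elements, phrased with integer
  polynomials. Synthetic division splits off a root \<open>x0\<close> with a remainder divisible by
  \<open>N\<close>; as \<open>N\<close> is prime, every other root modulo \<open>N\<close> is a root
  of the quotient.\<close>

lemma card_poly_roots_mod_prime:
  fixes f :: "int poly"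
  assumes "prime N" "\<not> (\<forall>i. int N dvd coeff f i)"
  shows "card {x\<in>{..<N}. int N dvd poly f (int x)} \<le> degree f"
  using assms(2)
proof (induction "degree f" arbitrary: f)
  case 0
  then obtain c where f: "f = [:c:]" by (metis degree_eq_zeroE)
  have "\<not> int N dvd c"
  proof
    assume "int N dvd c"
    hence "int N dvd coeff f i" for i unfolding f by (cases i) auto
    with 0 show False by blast
  qed
  thus ?case using f by simp
next
  case (Suc n)
  have pN: "prime (int N)" using assms by simp
  show ?case
  proof (cases "\<exists>x\<in>{..<N}. int N dvd poly f (int x)")
    case False
    hence "{x\<in>{..<N}. int N dvd poly f (int x)} = {}" by auto
    thus ?thesis by (simp del: Collect_empty_eq)
  next
    case True
    then obtain x0 where x0: "x0 < N" "int N dvd poly f (int x0)" by auto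
    define q where "q = synthetic_div f (int x0)"
    have eq: "f = [:- int x0, 1:] * q + [:poly f (int x0):]"
      unfolding q_def by (rule synthetic_div_correct'[symmetric])
    have degq: "degree q = n" using Suc.hyps(2) by (simp add: q_def degree_synthetic_div)
    have "\<not> (\<forall>i. int N dvd coeff q i)"
    proof
      assume *: "\<forall>i. int N dvd coeff q i"
      have "int N dvd coeff f i" for i
      proof -
        have "int N dvd coeff ([:- int x0, 1:] * q) i"
          unfolding coeff_mult using * by (intro dvd_sum dvd_mult) auto
        moreover have "int N dvd coeff [:poly f (int x0):] i" using x0 by (cases i) auto
        ultimately show ?thesis by (subst eq) (simp only: coeff_add dvd_add)
      qed
      with Suc.prems show False by blast
    qed
    with Suc.hyps(1)[of q] degq
    have IH: "card {x\<in>{..<N}. int N dvd poly q (int x)} \<le> n" by simp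
    have "{x\<in>{..<N}. int N dvd poly f (int x)} \<subseteq> insert x0 {x\<in>{..<N}. int N dvd poly q (int x)}"
    proof
      fix x assume x: "x \<in> {x\<in>{..<N}. int N dvd poly f (int x)}"
      have "poly f (int x) = (int x - int x0) * poly q (int x) + poly f (int x0)"
        by (subst eq) (simp add: algebra_simps)
      hence "int N dvd (int x - int x0) * poly q (int x)"
        using x x0 by (metis (no_types, lifting) dvd_add_left_iff mem_Collect_eq)
      hence "int N dvd int x - int x0 \<or> int N dvd poly q (int x)"
        using pN by (simp add: prime_dvd_mult_iff)
      moreover have "x = x0" if "int N dvd int x - int x0"
      proof -
        have "\<bar>int x - int x0\<bar> < int N" using x x0 by auto
        with that have "int x - int x0 = 0" using zdvd_imp_le[of "int N" "\<bar>int x - int x0\<bar>"] by auto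
        thus ?thesis by simp
      qed
      ultimately show "x \<in> insert x0 {x\<in>{..<N}. int N dvd poly q (int x)}" using x by auto
    qed
    hence "card {x\<in>{..<N}. int N dvd poly f (int x)} \<le> card (insert x0 {x\<in>{..<N}. int N dvd poly q (int x)})"
      by (intro card_mono) auto
    also have "\<dots> \<le> Suc n" using IH by (simp add: card_insert_if)
    finally show ?thesis using Suc.hyps(2) by simp
  qed
qed

text \<open>Integer coordinates of a nonzero vector in the dual of
  \<open>rank1_lattice d N z\<close>; values of \<open>h\<close> from index \<open>d\<close> on are
  left free.\<close>

definition dual_coeffs :: "nat \<Rightarrow> nat \<Rightarrow> (nat \<Rightarrow> int) \<Rightarrow> (nat \<Rightarrow> int) \<Rightarrow> bool" where
  "dual_coeffs d N z h \<longleftrightarrow> (\<exists>j<d. h j \<noteq> 0) \<and> int N dvd (\<Sum>j<d. h j * z j)"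

text \<open>Union bound: the box has \<open>(2 * R + 1) ^ d - 1\<close> nonzero vectors
  \<open>h\<close>, each dual for at most \<open>d - 1\<close> residues, the roots of the polynomial
  with coefficients \<open>h\<close>. The alternative \<open>R = 0\<close> serves primes too small
  for this count.\<close>

lemma exists_good_base:
  assumes N: "prime N" and d: "d \<ge> 1" and R: "R = 0 \<or> d * (2 * R + 1) ^ d \<le> N"
  shows "\<exists>b\<in>{1..<N}. \<forall>h. dual_coeffs d N (\<lambda>j. int (b ^ j)) h \<longrightarrow> (\<exists>j<d. \<bar>h j\<bar> > int R)"
proof (cases "R = 0")
  case True
  have "1 \<in> {1..<N}" using prime_gt_1_nat[OF N] by simp
  thus ?thesis using True by (auto simp: dual_coeffs_def intro!: bexI[of _ 1])
next
  case False
  define H where "H = (PiE {..<d} (\<lambda>_. {- int R..int R})) - {restrict (\<lambda>_. 0) {..<d}}"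
  define bad where "bad = (\<lambda>h::nat \<Rightarrow> int. {x\<in>{..<N}. int N dvd (\<Sum>j<d. h j * int (x ^ j))})"
  have Rd: "d * (2 * R + 1) ^ d \<le> N" using R False by simp
  have "(2 * R + 1) ^ 1 \<le> (2 * R + 1) ^ d" using d by (intro power_increasing) auto
  also have "\<dots> \<le> d * (2 * R + 1) ^ d" using d by simp
  \<comment> \<open>So a nonzero entry of a vector in the box stays nonzero modulo
    \<open>N\<close>.\<close>
  finally have RN: "R < N" using Rd by simp
  have finP: "finite (PiE {..<d} (\<lambda>_. {- int R..int R}))" by (intro finite_PiE) auto
  have "card (PiE {..<d} (\<lambda>_. {- int R..int R})) = (2 * R + 1) ^ d"
    by (simp add: card_PiE nat_add_distrib nat_mult_distrib)
  hence cardH: "card H = (2 * R + 1) ^ d - 1"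
    unfolding H_def by (subst card_Diff_singleton) auto
  have bad: "card (bad h) \<le> d - 1" if "h \<in> H" for h
  proof -
    have hP: "h \<in> PiE {..<d} (\<lambda>_. {- int R..int R})" "h \<noteq> restrict (\<lambda>_. 0) {..<d}"
      using that by (auto simp: H_def)
    obtain i where i: "i < d" "h i \<noteq> 0"
    proof (rule ccontr)
      assume "\<not> thesis"
      hence "\<forall>i<d. h i = 0" using that by blast
      hence "h = restrict (\<lambda>_. 0) {..<d}" using hP(1)
        by (intro ext) (auto simp: PiE_def extensional_def restrict_def)
      with hP(2) show False by simp
    qed
    define f where "f = (\<Sum>j<d. monom (h j) j)"
    have cf: "coeff f j = (if j < d then h j else 0)" for j
      unfolding f_def by (simp add: coeff_sum sum.delta)
    have "\<not> int N dvd h i"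
    proof
      assume "int N dvd h i"
      hence "int N \<le> \<bar>h i\<bar>" using i(2) by (metis abs_of_nat dvd_imp_le_int)
      also have "\<bar>h i\<bar> \<le> int R" using hP(1) i(1) by (auto simp: PiE_def Pi_def abs_le_iff)
      finally show False using RN by simp
    qed
    hence "\<not> (\<forall>i. int N dvd coeff f i)" using i cf by metis
    from card_poly_roots_mod_prime[OF N this]
    have "card {x \<in> {..<N}. int N dvd poly f (int x)} \<le> degree f" .
    moreover have "degree f \<le> d - 1" by (rule degree_le) (auto simp: cf)
    moreover have "poly f (int x) = (\<Sum>j<d. h j * int (x ^ j))" for x
      unfolding f_def by (simp add: poly_sum poly_monom)
    ultimately show ?thesis unfolding bad_def by simp
  qed
  have finH: "finite H" using finP by (simp add: H_def)
  have "card (\<Union>h\<in>H. bad h) \<le> (\<Sum>h\<in>H. card (bad h))" by (rule card_UN_le[OF finH])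
  also have "\<dots> \<le> (\<Sum>h\<in>H. d - 1)" by (rule sum_mono) (rule bad)
  also have "\<dots> = ((2 * R + 1) ^ d - 1) * (d - 1)" by (simp add: cardH)
  \<comment> \<open>The target is \<open>N - 1\<close> because the residue 0 is not an admissible
    base.\<close>
  also have "\<dots> < N - 1"
  proof -
    define X where "X = (2 * R + 1) ^ d - 1"
    have "(2 * R + 1) ^ 1 \<le> (2 * R + 1) ^ d" using d by (intro power_increasing) auto
    hence X: "(2 * R + 1) ^ d = X + 1" "X \<ge> 1" using False by (auto simp: X_def)
    obtain e where e: "d = e + 1" using d by (metis add.commute le_Suc_ex)
    have "d * (X + 1) \<le> N" using Rd by (simp only: X(1))
    hence "(e + 1) * (X + 1) \<le> N" by (simp only: e)
    hence "X * e + X + e + 1 \<le> N" by (simp add: algebra_simps)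
    hence "X * e < N - 1" using X(2) by linarith
    thus ?thesis using e X_def by simp
  qed
  finally have lt: "card (\<Union>h\<in>H. bad h) < card {1..<N}" by simp
  have "finite (\<Union>h\<in>H. bad h)" using finH by (auto simp: bad_def)
  hence "\<not> {1..<N} \<subseteq> (\<Union>h\<in>H. bad h)" using lt by (metis card_mono not_less)
  then obtain b where b: "b \<in> {1..<N}" "b \<notin> (\<Union>h\<in>H. bad h)" by blast
  show ?thesis
  proof (intro bexI[of _ b] allI impI)
    fix h assume h: "dual_coeffs d N (\<lambda>j. int (b ^ j)) h"
    show "\<exists>j<d. \<bar>h j\<bar> > int R"
    proof (rule ccontr)
      assume "\<not> ?thesis"
      hence small: "\<And>j. j < d \<Longrightarrow> \<bar>h j\<bar> \<le> int R" by (meson not_less)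
      obtain i where i: "i < d" "h i \<noteq> 0" using h by (auto simp: dual_coeffs_def)
      have "restrict h {..<d} i \<noteq> restrict (\<lambda>_. 0) {..<d} i" using i by simp
      hence "restrict h {..<d} \<noteq> restrict (\<lambda>_. 0) {..<d}" by metis
      moreover have "- int R \<le> h j \<and> h j \<le> int R" if "j < d" for j using small[OF that] by linarith
      ultimately have "restrict h {..<d} \<in> H" by (auto simp: H_def)
      moreover have "b \<in> bad (restrict h {..<d})"
        using h b(1) by (simp add: bad_def dual_coeffs_def)
      ultimately show False using b(2) by blast
    qed
  qed (use b in auto)
qed

section \<open>From dual vectors to lattice vectors\<close>

lemma sum_mod_cong_dvd:
  assumes "\<And>j. j < d \<Longrightarrow> int N dvd z j - z' j"
  shows "int N dvd (\<Sum>j<d. h j * z j) \<longleftrightarrow> int N dvd (\<Sum>j<d. h j * z' j)"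
proof -
  have "(\<Sum>j<d. h j * z j) = (\<Sum>j<d. h j * (z j - z' j)) + (\<Sum>j<d. h j * z' j)"
    by (simp add: algebra_simps flip: sum.distrib)
  moreover have "int N dvd (\<Sum>j<d. h j * (z j - z' j))" using assms by (intro dvd_sum dvd_mult) auto
  ultimately show ?thesis by (simp only: dvd_add_right_iff)
qed

lemma pow_mod_diff_dvd: "int N dvd int (b ^ j mod N) - int (b ^ j)"
  by (metis dvd_diff_commute zmod_int mod_eq_dvd_iff mod_mod_trivial)

text \<open>Pigeonhole: differences of the many points of a box of side \<open>C * M\<close> that agree modulo \<open>N\<close>
  are dual to the lattice and hence orthogonal to a short \<open>w\<close>, so that the coordinate \<open>i\<close> where
  \<open>w\<close> is largest is controlled by the others; cutting the others into cells of side about \<open>M / d\<close>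
  produces a dual vector that is too short.\<close>

lemma primal_vector_bound:
  assumes d: "d \<ge> 1" and M: "M \<ge> 1" and N: "N \<ge> 1" and NK: "N \<le> K * M ^ d"
    and dual: "\<And>h. dual_coeffs d N z h \<Longrightarrow> \<exists>j<d. \<bar>h j\<bar> \<ge> int M"
    and w0: "\<exists>j<d. w j \<noteq> 0" and w: "\<And>j. j < d \<Longrightarrow> int N dvd w j - n * z j"
  shows "int N \<le> int ((K * d ^ (d - 1) + 1) * M) * (\<Sum>j<d. \<bar>w j\<bar>)"
proof (rule ccontr)
  \<comment> \<open>The extra 1 makes the \<open>(C * M) ^ d\<close> points of the box strictly more
    numerous than the \<open>N * (C * d) ^ (d - 1)\<close> labels.\<close>
  define C where "C = K * d ^ (d - 1) + 1"
  define W where "W = (\<Sum>j<d. \<bar>w j\<bar>)"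
  assume "\<not> ?thesis"
  hence small: "int (C * M) * W < int N" by (simp add: C_def W_def)
  \<comment> \<open>The cell width is \<open>M / d\<close> rounded up: \<open>C * d\<close> cells
    cover an edge, yet \<open>d * (g - 1) < M\<close>.\<close>
  define g where "g = (M - 1) div d + 1"
  have dg: "d * (g - 1) < M" "M \<le> d * g"
  proof -
    have "d * ((M - 1) div d) \<le> M - 1" by (rule times_div_less_eq_dividend)
    hence "d * ((M - 1) div d) < M" using M by linarith
    thus "d * (g - 1) < M" by (simp add: g_def)
    have "M - 1 < d * ((M - 1) div d) + d" using d 
      by (metis add.commute div_mult_mod_eq mod_less_divisor mult.commute nat_add_left_cancel_less less_le_trans zero_less_one)
    thus "M \<le> d * g" using M by (simp add: g_def)
  qed
  have g1: "g \<ge> 1" by (simp add: g_def)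
  obtain i where i: "i < d" and imax: "\<And>j. j < d \<Longrightarrow> \<bar>w j\<bar> \<le> \<bar>w i\<bar>"
  proof -
    have "0 \<in> {..<d}" using d by simp
    hence ne: "finite ((\<lambda>j. \<bar>w j\<bar>) ` {..<d})" "(\<lambda>j. \<bar>w j\<bar>) ` {..<d} \<noteq> {}" by blast+
    from Max_in[OF ne] obtain i where "i < d" "\<bar>w i\<bar> = Max ((\<lambda>j. \<bar>w j\<bar>) ` {..<d})" by auto
    with Max_ge[OF ne(1)] show ?thesis by (intro that[of i]) auto
  qed
  have wi: "\<bar>w i\<bar> > 0" using w0 imax by force
  define Q where "Q = PiE {..<d} (\<lambda>_. {..<C * M})"
  define T where "T = {..<N} \<times> PiE ({..<d} - {i}) (\<lambda>_. {..<C * d})"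
  \<comment> \<open>A label records the residue modulo \<open>N\<close> and the cells of all
    coordinates except \<open>i\<close>.\<close>
  define \<phi> where "\<phi> = (\<lambda>q::nat\<Rightarrow>nat. (nat ((\<Sum>j<d. int (q j) * z j) mod int N), restrict (\<lambda>j. q j div g) ({..<d} - {i})))"
  have "card T = N * (C * d) ^ (d - 1)" using i by (simp add: T_def card_PiE card_cartesian_product)
  also have "\<dots> \<le> K * M ^ d * (C * d) ^ (d - 1)" using NK by (intro mult_right_mono) auto
  also have "\<dots> = (K * d ^ (d - 1)) * (C ^ (d - 1) * M ^ d)" by (simp add: power_mult_distrib)
  also have "\<dots> < C * (C ^ (d - 1) * M ^ d)" using M by (intro mult_strict_right_mono) (auto simp: C_def)
  also have "\<dots> = (C * M) ^ d" using d by (cases d) (simp_all add: power_mult_distrib)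
  also have "\<dots> = card Q" by (simp add: Q_def card_PiE)
  finally have cardlt: "card T < card Q" .
  have "\<phi> ` Q \<subseteq> T"
  proof (rule image_subsetI)
    fix q assume q: "q \<in> Q"
    have "q j div g < C * d" if "j < d" for j
    proof -
      have "q j < C * M" using q that by (auto simp: Q_def PiE_def Pi_def)
      also have "\<dots> \<le> C * d * g" using dg(2) by simp
      finally show ?thesis using g1 by (simp add: less_mult_imp_div_less)
    qed
    moreover have "nat ((\<Sum>j<d. int (q j) * z j) mod int N) < N" using N by (simp add: nat_less_iff)
    ultimately show "\<phi> q \<in> T" by (auto simp: \<phi>_def T_def)
  qed
  moreover have "finite T" by (auto simp: T_def intro!: finite_PiE)
  ultimately have "card (\<phi> ` Q) < card Q" using cardlt by (meson card_mono le_less_trans)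
  hence "\<not> inj_on \<phi> Q" by (rule pigeonhole)
  then obtain q q' where q: "q \<in> Q" "q' \<in> Q" "q \<noteq> q'" "\<phi> q = \<phi> q'" by (auto simp: inj_on_def)
  define h where "h = (\<lambda>j. int (q j) - int (q' j))"
  have h0: "\<exists>j<d. h j \<noteq> 0"
    using q(1-3) unfolding h_def Q_def by (metis PiE_ext lessThan_iff of_nat_eq_iff right_minus_eq)
  have modeq: "(\<Sum>j<d. int (q j) * z j) mod int N = (\<Sum>j<d. int (q' j) * z j) mod int N"
    using q(4) N by (simp add: \<phi>_def eq_nat_nat_iff)
  hence hz: "int N dvd (\<Sum>j<d. h j * z j)"
    by (simp add: mod_eq_dvd_iff h_def left_diff_distrib sum_subtractf)
  have hcell: "\<bar>h j\<bar> \<le> int (g - 1)" if "j < d" "j \<noteq> i" for j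
  proof -
    define t where "t = g * (q j div g)"
    have "q j div g = q' j div g"
      using q(4) that by (auto simp: \<phi>_def dest!: fun_cong[of _ _ j])
    hence "q j = t + q j mod g" "q' j = t + q' j mod g"
      by (metis mult_div_mod_eq t_def)+
    moreover have "q j mod g < g" "q' j mod g < g" using g1 by simp_all
    ultimately show ?thesis unfolding h_def using g1 by linarith
  qed
  have hbox: "\<bar>h j\<bar> \<le> int (C * M)" if "j < d" for j
  proof -
    have "q j < C * M" "q' j < C * M" using q that by (auto simp: Q_def PiE_def Pi_def)
    thus ?thesis unfolding h_def by linarith
  qed
  \<comment> \<open>Modulo \<open>N\<close> this sum is \<open>n\<close> times the sum of the
    \<open>h j * z j\<close>, hence 0; by \<open>small\<close> its absolute value is below
    \<open>N\<close>.\<close>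
  have hw: "(\<Sum>j<d. h j * w j) = 0"
  proof (rule ccontr)
    assume ne: "(\<Sum>j<d. h j * w j) \<noteq> 0"
    have "(\<Sum>j<d. h j * w j) = (\<Sum>j<d. h j * (w j - n * z j)) + n * (\<Sum>j<d. h j * z j)"
      by (simp add: sum_distrib_left algebra_simps sum_subtractf)
    moreover have "int N dvd (\<Sum>j<d. h j * (w j - n * z j))" using w by (intro dvd_sum dvd_mult) auto
    ultimately have "int N dvd (\<Sum>j<d. h j * w j)" using hz by simp
    hence "int N \<le> \<bar>\<Sum>j<d. h j * w j\<bar>" using ne by (metis abs_of_nat dvd_imp_le_int)
    also have "\<dots> \<le> (\<Sum>j<d. \<bar>h j\<bar> * \<bar>w j\<bar>)" by (rule order_trans[OF sum_abs]) (simp add: abs_mult)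
    also have "\<dots> \<le> (\<Sum>j<d. int (C * M) * \<bar>w j\<bar>)" by (intro sum_mono mult_right_mono) (use hbox in auto)
    also have "\<dots> = int (C * M) * W" by (simp add: W_def sum_distrib_left)
    finally show False using small by simp
  qed
  \<comment> \<open>Solving for \<open>h i\<close>: as \<open>w i\<close> is a largest entry, each
    of the other \<open>d - 1\<close> coordinates contributes at most \<open>g - 1\<close>.\<close>
  have "h i * w i = - (\<Sum>j\<in>{..<d} - {i}. h j * w j)"
    using hw i by (simp add: sum.remove[of "{..<d}" i])
  hence "\<bar>h i\<bar> * \<bar>w i\<bar> = \<bar>\<Sum>j\<in>{..<d} - {i}. h j * w j\<bar>" by (simp flip: abs_mult)
  also have "\<dots> \<le> (\<Sum>j\<in>{..<d} - {i}. \<bar>h j\<bar> * \<bar>w j\<bar>)" by (rule order_trans[OF sum_abs]) (simp add: abs_mult)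
  also have "\<dots> \<le> (\<Sum>j\<in>{..<d} - {i}. int (g - 1) * \<bar>w i\<bar>)"
    by (intro sum_mono mult_mono) (use hcell imax in auto)
  also have "\<dots> = int ((d - 1) * (g - 1)) * \<bar>w i\<bar>" using i by simp
  finally have "\<bar>h i\<bar> \<le> int ((d - 1) * (g - 1))" using wi by simp
  also have "\<dots> \<le> int (d * (g - 1))" by (intro of_nat_mono mult_right_mono) auto
  finally have hi: "\<bar>h i\<bar> < int M" using dg(1) by linarith
  have "g - 1 \<le> d * (g - 1)" using d by simp
  hence "int (g - 1) < int M" using dg(1) by linarith
  hence "\<bar>h j\<bar> < int M" if "j < d" for j using hcell[of j] hi that by (cases "j = i") auto
  thus False using dual[of h] h0 hz by (force simp: dual_coeffs_def)
qed

section \<open>Fourier bound for the covering radius\<close>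

lemma sum_cis_eq_0:
  assumes "N \<ge> 1" "\<not> int N dvd a"
  shows "(\<Sum>n<N. cis (2 * pi * (real n * of_int a / real N))) = 0"
proof -
  define w where "w = cis (2 * pi * (of_int a / real N))"
  have "w \<noteq> 1"
  proof
    assume "w = 1"
    hence "cos (2 * pi * (of_int a / real N)) = 1" by (simp add: w_def complex_eq_iff)
    then obtain k :: int where "2 * pi * (of_int a / real N) = k * 2 * pi"
      by (auto simp: cos_one_2pi_int)
    hence "real_of_int a = of_int (k * int N)" using assms(1) by (simp add: field_simps)
    hence "a = k * int N" by (simp only: of_int_eq_iff)
    with assms(2) show False by simp
  qed
  moreover have "w ^ N = 1"
  proof -
    have "real N * (2 * pi * (of_int a / real N)) = 2 * pi * of_int a" using assms(1) by simp
    thus ?thesis unfolding w_def Complex.DeMoivre by (simp only:) (simp add: cis_multiple_2pi)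
  qed
  ultimately have "(\<Sum>n<N. w ^ n) = 0" by (simp add: geometric_sum)
  thus ?thesis by (simp add: w_def Complex.DeMoivre mult_ac)
qed

text \<open>Parseval: after expanding the square, the mixed terms vanish by
  \<open>sum_cis_eq_0\<close>, since the frequencies are pairwise incongruent modulo
  \<open>N\<close>.\<close>

lemma sum_cmod_square_exponential_sum:
  fixes g :: "'a \<Rightarrow> complex" and v :: "'a \<Rightarrow> int"
  assumes N: "N \<ge> 1" and K: "finite K"
    and inj: "\<And>k k'. k \<in> K \<Longrightarrow> k' \<in> K \<Longrightarrow> int N dvd v k - v k' \<Longrightarrow> k = k'"
  shows "(\<Sum>n<N. (cmod (\<Sum>k\<in>K. g k * cis (2 * pi * (real n * of_int (v k) / real N))))\<^sup>2)
           = real N * (\<Sum>k\<in>K. (cmod (g k))\<^sup>2)"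
proof -
  let ?e = "\<lambda>n k. cis (2 * pi * (real n * of_int (v k) / real N))"
  have orth: "(\<Sum>n<N. ?e n k * cnj (?e n k')) = (if k = k' then of_nat N else 0)"
    if "k \<in> K" "k' \<in> K" for k k'
  proof -
    have "?e n k * cnj (?e n k') = cis (2 * pi * (real n * of_int (v k - v k') / real N))" for n
      by (simp add: cis_cnj cis_mult algebra_simps diff_divide_distrib)
    hence "(\<Sum>n<N. ?e n k * cnj (?e n k')) = (\<Sum>n<N. cis (2 * pi * (real n * of_int (v k - v k') / real N)))"
      by simp
    also have "\<dots> = (if k = k' then of_nat N else 0)"
    proof (cases "k = k'")
      case False
      hence "\<not> int N dvd v k - v k'" using inj that by blast
      from sum_cis_eq_0[OF N this] False show ?thesis by simp
    qed simp
    finally show ?thesis .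
  qed
  have "complex_of_real (\<Sum>n<N. (cmod (\<Sum>k\<in>K. g k * ?e n k))\<^sup>2)
      = (\<Sum>n<N. (\<Sum>k\<in>K. g k * ?e n k) * (\<Sum>k'\<in>K. cnj (g k') * cnj (?e n k')))"
    by (simp only: of_real_sum complex_norm_square cnj_sum complex_cnj_mult)
  also have "\<dots> = (\<Sum>n<N. \<Sum>k\<in>K. \<Sum>k'\<in>K. g k * cnj (g k') * (?e n k * cnj (?e n k')))"
    by (simp add: sum_product mult_ac)
  also have "\<dots> = (\<Sum>k\<in>K. \<Sum>k'\<in>K. g k * cnj (g k') * (\<Sum>n<N. ?e n k * cnj (?e n k')))"
    by (subst sum.swap, rule sum.cong[OF refl], subst sum.swap) (simp add: sum_distrib_left)
  also have "\<dots> = (\<Sum>k\<in>K. \<Sum>k'\<in>K. g k * cnj (g k') * (if k = k' then of_nat N else 0))"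
    using orth by (intro sum.cong) auto
  also have "\<dots> = (\<Sum>k\<in>K. g k * cnj (g k) * of_nat N)"
    using K by (intro sum.cong refl) (simp add: if_distrib sum.delta cong: if_cong)
  also have "\<dots> = complex_of_real (real N * (\<Sum>k\<in>K. (cmod (g k))\<^sup>2))"
    by (simp only: of_real_mult of_real_sum of_real_of_nat_eq complex_norm_square sum_distrib_left mult_ac)
  finally show ?thesis by (simp only: of_real_eq_iff)
qed

lemma cmod_cis_minus_one: "cmod (cis t - 1) = 2 * \<bar>sin (t / 2)\<bar>"
proof -
  have "(cmod (cis t - 1))\<^sup>2 = (cos t - 1)\<^sup>2 + (sin t)\<^sup>2" by (simp add: cmod_power2)
  also have "\<dots> = 2 - 2 * cos t" using sin_cos_squared_add[of t] by (simp add: power2_diff)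
  also have "cos t = 1 - 2 * (sin (t / 2))\<^sup>2" using cos_double_sin[of "t / 2"] by simp
  finally have "(cmod (cis t - 1))\<^sup>2 = (2 * \<bar>sin (t / 2)\<bar>)\<^sup>2" by (simp add: power_mult_distrib)
  thus ?thesis by (rule power2_eq_imp_eq) auto
qed

text \<open>By concavity the sine lies above the chord joining its values at \<open>u = 0\<close>
  and \<open>u = 1 / 2\<close>.\<close>

lemma jordan_sin_le:
  fixes u :: real
  assumes "0 \<le> u" "u \<le> 1 / 2"
  shows "2 * u \<le> sin (pi * u)"
proof -
  have "convex_on {0..1/2} (\<lambda>u. - sin (pi * u))"
    by (rule f''_ge0_imp_convex[where f' = "\<lambda>u. - (pi * cos (pi * u))" and f'' = "\<lambda>u. pi\<^sup>2 * sin (pi * u)"])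
      (auto intro!: derivative_eq_intros mult_nonneg_nonneg sin_ge_zero simp: power2_eq_square field_simps)
  from convex_onD[OF this, of "2 * u" 0 "1/2"] assms show ?thesis by simp
qed

text \<open>Subtracting \<open>round t\<close> leaves the exponential unchanged and brings the
  argument into the range of \<open>jordan_sin_le\<close>.\<close>

lemma dist_int_le_cmod_cis:
  fixes t :: real
  shows "4 * \<bar>t - of_int (round t)\<bar> \<le> cmod (cis (2 * pi * t) - 1)"
proof -
  define u where "u = t - of_int (round t)"
  have u: "\<bar>u\<bar> \<le> 1 / 2" using of_int_round_abs_le[of t] by (simp add: u_def abs_minus_commute)
  have "cis (2 * pi * t) = cis (2 * pi * u) * cis (2 * pi * of_int (round t))"
    by (simp add: u_def cis_mult algebra_simps)
  hence "cmod (cis (2 * pi * t) - 1) = 2 * \<bar>sin (pi * u)\<bar>" by (simp add: cmod_cis_minus_one)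
  moreover have "\<bar>sin (pi * u)\<bar> = \<bar>sin (pi * \<bar>u\<bar>)\<bar>" by (cases "u \<ge> 0") auto
  moreover have "2 * \<bar>u\<bar> \<le> \<bar>sin (pi * \<bar>u\<bar>)\<bar>" using jordan_sin_le[of "\<bar>u\<bar>"] u by linarith
  ultimately have "4 * \<bar>u\<bar> \<le> cmod (cis (2 * pi * t) - 1)" by linarith
  thus ?thesis by (simp add: u_def)
qed

text \<open>Multiplying out gives one exponential per multi-index with entries in 0, ...,
  \<open>m\<close>. Two multi-indices differ by entries of absolute value at most \<open>m\<close>,
  so \<open>nd\<close> keeps their frequencies distinct modulo \<open>N\<close> and Parseval
  applies.\<close>

lemma box_parseval:
  fixes \<gamma> :: "nat \<Rightarrow> nat \<Rightarrow> real" and x :: "nat \<Rightarrow> real" and z :: "nat \<Rightarrow> int"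
  assumes N: "N \<ge> 1"
    and nd: "\<And>h. dual_coeffs d N z h \<Longrightarrow> \<exists>j<d. \<bar>h j\<bar> > int m"
  shows "(\<Sum>n<N. (\<Prod>j<d. (cmod (\<Sum>k\<le>m. \<gamma> j k * cis (2 * pi * (x j - real n * of_int (z j) / real N)) ^ k))\<^sup>2))
           = real N * (\<Prod>j<d. \<Sum>k\<le>m. (\<gamma> j k)\<^sup>2)"
proof -
  define K where "K = PiE {..<d} (\<lambda>_. {..m})"
  define v where "v = (\<lambda>\<kappa>::nat\<Rightarrow>nat. - (\<Sum>j<d. int (\<kappa> j) * z j))"
  define g where "g = (\<lambda>\<kappa>::nat\<Rightarrow>nat. \<Prod>j<d. of_real (\<gamma> j (\<kappa> j)) * cis (2 * pi * x j) ^ \<kappa> j)"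
  have K: "finite K" by (auto simp: K_def intro!: finite_PiE)
  have inj: "k = k'" if k: "k \<in> K" "k' \<in> K" and dv: "int N dvd v k - v k'" for k k'
  proof (rule ccontr)
    assume ne: "k \<noteq> k'"
    define h where "h = (\<lambda>j. int (k' j) - int (k j))"
    have h0: "\<exists>j<d. h j \<noteq> 0"
      using k ne unfolding h_def K_def by (metis PiE_ext lessThan_iff of_nat_eq_iff right_minus_eq)
    have "(\<Sum>j<d. h j * z j) = v k - v k'"
      by (simp add: h_def v_def left_diff_distrib sum_subtractf)
    with h0 dv have "dual_coeffs d N z h" by (simp add: dual_coeffs_def)
    then obtain j where j: "j < d" "\<bar>h j\<bar> > int m" using nd by blast
    moreover have "k j \<le> m" "k' j \<le> m" using k j(1) by (auto simp: K_def PiE_def Pi_def)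
    ultimately show False unfolding h_def by linarith
  qed
  have cis_prod: "(\<Prod>j\<in>A. cis (f j)) = cis (\<Sum>j\<in>A. f j)" if "finite A" for A :: "nat set" and f
    using that by (induction A rule: finite_induct) (simp_all add: cis_mult)
  have "(\<Prod>j<d. \<Sum>k\<le>m. \<gamma> j k * cis (2 * pi * (x j - real n * of_int (z j) / real N)) ^ k)
      = (\<Sum>\<kappa>\<in>K. g \<kappa> * cis (2 * pi * (real n * of_int (v \<kappa>) / real N)))" for n
  proof -
    have "(\<Prod>j<d. \<Sum>k\<le>m. \<gamma> j k * cis (2 * pi * (x j - real n * of_int (z j) / real N)) ^ k)
        = (\<Sum>\<kappa>\<in>K. \<Prod>j<d. \<gamma> j (\<kappa> j) * cis (2 * pi * (x j - real n * of_int (z j) / real N)) ^ \<kappa> j)"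
      unfolding K_def by (rule prod_sum_PiE) auto
    also have "\<dots> = (\<Sum>\<kappa>\<in>K. g \<kappa> * cis (2 * pi * (real n * of_int (v \<kappa>) / real N)))"
    proof (rule sum.cong[OF refl])
      fix \<kappa>
      have "(\<Prod>j<d. \<gamma> j (\<kappa> j) * cis (2 * pi * (x j - real n * of_int (z j) / real N)) ^ \<kappa> j)
          = (\<Prod>j<d. (\<gamma> j (\<kappa> j) * cis (2 * pi * x j) ^ \<kappa> j) *
               cis (- (2 * pi * (real n * (real (\<kappa> j) * of_int (z j)) / real N))))"
      proof (intro prod.cong refl)
        fix j
        have "cis (2 * pi * (x j - real n * of_int (z j) / real N)) ^ \<kappa> j = cis (2 * pi * x j) ^ \<kappa> j *
               cis (- (2 * pi * (real n * (real (\<kappa> j) * of_int (z j)) / real N)))"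
          unfolding Complex.DeMoivre cis_mult by (rule arg_cong[where f = cis]) (simp add: algebra_simps)
        thus "\<gamma> j (\<kappa> j) * cis (2 * pi * (x j - real n * of_int (z j) / real N)) ^ \<kappa> j =
          (\<gamma> j (\<kappa> j) * cis (2 * pi * x j) ^ \<kappa> j) *
            cis (- (2 * pi * (real n * (real (\<kappa> j) * of_int (z j)) / real N)))" by simp
      qed
      also have "\<dots> = g \<kappa> * cis (\<Sum>j<d. - (2 * pi * (real n * (real (\<kappa> j) * of_int (z j)) / real N)))"
        unfolding prod.distrib g_def by (simp add: cis_prod)
      also have "(\<Sum>j<d. - (2 * pi * (real n * (real (\<kappa> j) * of_int (z j)) / real N)))
          = 2 * pi * (real n * of_int (v \<kappa>) / real N)"
        by (simp add: v_def sum_negf sum_distrib_left sum_divide_distrib)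
      finally show "(\<Prod>j<d. \<gamma> j (\<kappa> j) * cis (2 * pi * (x j - real n * of_int (z j) / real N)) ^ \<kappa> j)
          = g \<kappa> * cis (2 * pi * (real n * of_int (v \<kappa>) / real N))" .
    qed
    finally show ?thesis .
  qed
  note expand = this
  have "(\<Sum>n<N. (\<Prod>j<d. (cmod (\<Sum>k\<le>m. \<gamma> j k * cis (2 * pi * (x j - real n * of_int (z j) / real N)) ^ k))\<^sup>2))
      = (\<Sum>n<N. (cmod (\<Sum>\<kappa>\<in>K. g \<kappa> * cis (2 * pi * (real n * of_int (v \<kappa>) / real N))))\<^sup>2)"
    by (simp only: expand[symmetric] prod_norm[symmetric] prod_power_distrib)
  also have "\<dots> = real N * (\<Sum>\<kappa>\<in>K. (cmod (g \<kappa>))\<^sup>2)"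
    by (rule sum_cmod_square_exponential_sum[OF N K inj])
  also have "(\<Sum>\<kappa>\<in>K. (cmod (g \<kappa>))\<^sup>2) = (\<Sum>\<kappa>\<in>K. \<Prod>j<d. (\<gamma> j (\<kappa> j))\<^sup>2)"
    by (simp add: g_def norm_mult norm_power prod_power_distrib flip: prod_norm)
  also have "\<dots> = (\<Prod>j<d. \<Sum>k\<le>m. (\<gamma> j k)\<^sup>2)"
    unfolding K_def by (rule prod_sum_PiE[symmetric]) auto
  finally show ?thesis .
qed

text \<open>Keeping \<open>t\<close> separate from the summation bound lets the induction go
  through; the application takes \<open>t = n\<close>.\<close>

lemma sum_square_parabola:
  "(\<Sum>k\<le>n. (real k * (t - real k))\<^sup>2) =
     t\<^sup>2 * (real n * (real n + 1) * (2 * real n + 1) / 6) - t * (real n * (real n + 1))\<^sup>2 / 2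
     + real n * (real n + 1) * (2 * real n + 1) * (3 * (real n)\<^sup>2 + 3 * real n - 1) / 30"
  by (induction n) (simp_all add: field_simps power2_eq_square)

text \<open>The sum equals \<open>m * (m ^ 4 - 1) / 30\<close>, and \<open>m \<ge> 2\<close> gives
  \<open>m ^ 4 - 1 \<ge> 15 / 16 * m ^ 4\<close>, whence the constant 32.\<close>

lemma sum_square_parabola_ge:
  assumes "m \<ge> 2"
  shows "(\<Sum>k\<le>m. (real k * (real m - real k))\<^sup>2) \<ge> real m ^ 5 / 32"
proof -
  have "(\<Sum>k\<le>m. (real k * (real m - real k))\<^sup>2) = real m * (real m ^ 4 - 1) / 30"
    unfolding sum_square_parabola by (simp add: field_simps power2_eq_square power4_eq_xxxx)
  moreover have "real m ^ 4 \<ge> 2 ^ 4" using assms by (intro power_mono) auto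
  hence "real m * (real m ^ 4 - 1) \<ge> real m * (15 / 16 * real m ^ 4)" by (intro mult_left_mono) auto
  ultimately show ?thesis by (simp add: power_numeral_reduce)
qed

text \<open>Averaging over the weights \<open>\<bar>f (x - x\<^sub>n)\<bar>\<^sup>2\<close>, where \<open>f\<close> is the product of the kernels
  \<open>\<Sum>k\<le>m. k (m - k) e(k t)\<close>: multiplying \<open>f\<close> by \<open>e(t\<^sub>j) - 1\<close> replaces the coefficients in
  direction \<open>j\<close> by their differences, whose square sum is smaller by a factor \<open>32 / m\<^sup>2\<close>.\<close>

lemma exists_near_lattice_point_cis:
  fixes x :: "nat \<Rightarrow> real" and z :: "nat \<Rightarrow> int"
  assumes N: "N \<ge> 1" and m: "m \<ge> 2"
    and nd: "\<And>h. dual_coeffs d N z h \<Longrightarrow> \<exists>j<d. \<bar>h j\<bar> > int m"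
  shows "\<exists>n<N. (\<Sum>j<d. (cmod (cis (2 * pi * (x j - real n * of_int (z j) / real N)) - 1))\<^sup>2) \<le> 32 * real d / (real m)\<^sup>2"
proof (rule ccontr)
  assume neg: "\<not> ?thesis"
  define E where "E = (\<lambda>j n. cis (2 * pi * (x j - real n * of_int (z j) / real N)))"
  \<comment> \<open>The coefficients vanish at \<open>k = 0\<close> and \<open>k = m\<close>, so
    multiplication by \<open>E j n - 1\<close> keeps the degree at most \<open>m\<close>.\<close>
  define c where "c = (\<lambda>k. real k * (real m - real k))"
  define c' where "c' = (\<lambda>k. (case k of 0 \<Rightarrow> 0 | Suc k' \<Rightarrow> c k') - c k)"
  define f where "f = (\<lambda>j n. \<Sum>k\<le>m. c k * E j n ^ k)"
  define F where "F = (\<lambda>n. \<Prod>j<d. (cmod (f j n))\<^sup>2)"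
  define S where "S = (\<Sum>k\<le>m. (c k)\<^sup>2)"
  define D where "D = (\<Sum>k\<le>m. (c' k)\<^sup>2)"
  have S: "S \<ge> real m ^ 5 / 32" unfolding S_def c_def by (rule sum_square_parabola_ge[OF m])
  have S0: "S > 0" using m by (intro less_le_trans[OF _ S]) auto
  obtain m' where m': "m = Suc m'" using m by (cases m) auto
  \<comment> \<open>Differences of a parabola are linear, here at most \<open>m\<close> in absolute
    value, while \<open>S\<close> has order \<open>m ^ 5\<close>.\<close>
  have D: "D \<le> real m ^ 3"
  proof -
    have "D = (\<Sum>k\<le>m'. (c' (Suc k))\<^sup>2)"
      unfolding D_def m' by (subst sum.atMost_Suc_shift) (simp add: c'_def c_def)
    also have "\<dots> \<le> (\<Sum>k\<le>m'. (real m)\<^sup>2)"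
    proof (rule sum_mono)
      fix k assume k: "k \<in> {..m'}"
      have "c' (Suc k) = 2 * real k + 1 - real m" by (simp add: c'_def c_def algebra_simps)
      hence "\<bar>c' (Suc k)\<bar> \<le> \<bar>real m\<bar>" using k m' by auto
      thus "(c' (Suc k))\<^sup>2 \<le> (real m)\<^sup>2" by (simp only: abs_le_square_iff)
    qed
    also have "\<dots> = real m ^ 3" by (simp add: m' power2_eq_square power3_eq_cube)
    finally show ?thesis .
  qed
  have DS: "D \<le> 32 / (real m)\<^sup>2 * S"
  proof -
    have "real m ^ 3 = 32 / (real m)\<^sup>2 * (real m ^ 5 / 32)" using m by (simp add: field_simps flip: power_add)
    also have "\<dots> \<le> 32 / (real m)\<^sup>2 * S" using S by (intro mult_left_mono) auto
    finally show ?thesis using D by linarith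
  qed
  have shift: "f j n * (E j n - 1) = (\<Sum>k\<le>m. c' k * E j n ^ k)" for j n
  proof -
    have "c (Suc m') = 0" by (simp add: c_def m')
    hence "f j n * E j n = (\<Sum>k\<le>m'. c k * E j n ^ Suc k)"
      unfolding f_def m' by (simp add: sum_distrib_left mult_ac)
    also have "\<dots> = (\<Sum>k\<le>m. (case k of 0 \<Rightarrow> 0 | Suc k' \<Rightarrow> c k') * E j n ^ k)"
      unfolding m' by (subst sum.atMost_Suc_shift) simp
    finally show ?thesis
      by (simp add: algebra_simps c'_def sum_subtractf) (simp add: f_def)
  qed
  have parseval: "(\<Sum>n<N. (\<Prod>j<d. (cmod (\<Sum>k\<le>m. \<gamma> j k * E j n ^ k))\<^sup>2)) =
      real N * (\<Prod>j<d. \<Sum>k\<le>m. (\<gamma> j k)\<^sup>2)" for \<gamma> :: "nat \<Rightarrow> nat \<Rightarrow> real"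
    unfolding E_def by (rule box_parseval) (fact N, fact nd)
  have sumF: "(\<Sum>n<N. F n) = real N * S ^ d"
    using parseval[of "\<lambda>_. c"] by (simp add: F_def f_def S_def)
  have sumFi: "(\<Sum>n<N. F n * (cmod (E i n - 1))\<^sup>2) \<le> 32 / (real m)\<^sup>2 * (real N * S ^ d)" if i: "i < d" for i
  proof -
    define \<gamma> where "\<gamma> = (\<lambda>j. if j = i then c' else c)"
    have split: "(\<Prod>j<d. G j) = G i * (\<Prod>j\<in>{..<d} - {i}. G j)" for G :: "nat \<Rightarrow> real"
      using i by (simp add: prod.remove)
    have "(\<Prod>j<d. (cmod (\<Sum>k\<le>m. \<gamma> j k * E j n ^ k))\<^sup>2) = F n * (cmod (E i n - 1))\<^sup>2" for n
      unfolding F_def split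
      by (simp add: \<gamma>_def shift[symmetric] norm_mult power_mult_distrib)
         (simp add: f_def)
    hence "(\<Sum>n<N. F n * (cmod (E i n - 1))\<^sup>2) = real N * (\<Prod>j<d. \<Sum>k\<le>m. (\<gamma> j k)\<^sup>2)"
      using parseval[of \<gamma>] by simp
    also have "(\<Prod>j<d. \<Sum>k\<le>m. (\<gamma> j k)\<^sup>2) = D * S ^ (d - 1)"
      unfolding split using i by (simp add: \<gamma>_def D_def S_def)
    also have "real N * (D * S ^ (d - 1)) \<le> real N * (32 / (real m)\<^sup>2 * S * S ^ (d - 1))"
      using DS S0 by (intro mult_left_mono mult_right_mono) auto
    also have "\<dots> = 32 / (real m)\<^sup>2 * (real N * S ^ d)" using i by (cases d) auto
    finally show ?thesis .
  qed
  have big: "(\<Sum>j<d. (cmod (E j n - 1))\<^sup>2) > 32 * real d / (real m)\<^sup>2" if "n < N" for n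
    using neg that by (auto simp: E_def not_le)
  have Fnn: "F n \<ge> 0" for n by (simp add: F_def prod_nonneg)
  \<comment> \<open>One positive weight makes the averaged inequality strict, as the contradiction
    requires.\<close>
  have "\<exists>n<N. F n > 0"
  proof (rule ccontr)
    assume "\<not> ?thesis"
    hence "(\<Sum>n<N. F n) \<le> 0" by (intro sum_nonpos) (meson lessThan_iff not_less)
    moreover have "real N * S ^ d > 0" using S0 N by simp
    ultimately show False using sumF by linarith
  qed
  then obtain n0 where n0: "n0 < N" "F n0 > 0" by blast
  have "(\<Sum>n<N. F n * (32 * real d / (real m)\<^sup>2)) < (\<Sum>n<N. F n * (\<Sum>j<d. (cmod (E j n - 1))\<^sup>2))"
  proof (rule sum_strict_mono_ex1)
    show "\<forall>n\<in>{..<N}. F n * (32 * real d / (real m)\<^sup>2) \<le> F n * (\<Sum>j<d. (cmod (E j n - 1))\<^sup>2)"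
      using big Fnn by (intro ballI mult_left_mono) (auto intro: less_imp_le)
    show "\<exists>n\<in>{..<N}. F n * (32 * real d / (real m)\<^sup>2) < F n * (\<Sum>j<d. (cmod (E j n - 1))\<^sup>2)"
      using big n0 by (intro bexI[of _ n0] mult_strict_left_mono) auto
  qed auto
  also have "\<dots> = (\<Sum>j<d. \<Sum>n<N. F n * (cmod (E j n - 1))\<^sup>2)"
    by (subst sum.swap) (simp add: sum_distrib_left)
  also have "\<dots> \<le> (\<Sum>j<d. 32 / (real m)\<^sup>2 * (real N * S ^ d))" using sumFi by (intro sum_mono) auto
  also have "\<dots> = (\<Sum>n<N. F n) * (32 * real d / (real m)\<^sup>2)" by (simp add: sumF mult_ac)
  finally show False by (simp only: sum_distrib_right less_irrefl)
qed

lemma exists_near_lattice_point: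
  fixes x :: "nat \<Rightarrow> real" and z :: "nat \<Rightarrow> int"
  assumes N: "N \<ge> 1" and m: "m \<ge> 2"
    and nd: "\<And>h. dual_coeffs d N z h \<Longrightarrow> \<exists>j<d. \<bar>h j\<bar> > int m"
  shows "\<exists>n<N. \<exists>k::nat \<Rightarrow> int. \<forall>j<d. \<bar>x j - (real n * of_int (z j) / real N + of_int (k j))\<bar> \<le> 2 * real d / real m"
proof -
  obtain n where n: "n < N"
    "(\<Sum>j<d. (cmod (cis (2 * pi * (x j - real n * of_int (z j) / real N)) - 1))\<^sup>2) \<le> 32 * real d / (real m)\<^sup>2"
    using exists_near_lattice_point_cis[OF N m nd] by blast
  define t where "t = (\<lambda>j. x j - real n * of_int (z j) / real N)"
  have "\<bar>t j - of_int (round (t j))\<bar> \<le> 2 * real d / real m" if j: "j < d" for j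
  proof -
    have "(4 * \<bar>t j - of_int (round (t j))\<bar>)\<^sup>2 \<le> (cmod (cis (2 * pi * t j) - 1))\<^sup>2"
      by (intro power_mono dist_int_le_cmod_cis) auto
    also have "\<dots> \<le> (\<Sum>j<d. (cmod (cis (2 * pi * t j) - 1))\<^sup>2)"
      using j by (intro member_le_sum) auto
    also have "\<dots> \<le> 32 * real d / (real m)\<^sup>2" using n(2) by (simp add: t_def)
    \<comment> \<open>Enlarging \<open>d\<close> to its square makes the right-hand side a perfect
      square.\<close>
    also have "\<dots> \<le> 64 * (real d)\<^sup>2 / (real m)\<^sup>2"
    proof -
      have "1 * real d \<le> real d * real d" using j by (intro mult_right_mono) auto
      thus ?thesis by (intro divide_right_mono) (auto simp: power2_eq_square)
    qed
    also have "\<dots> = (4 * (2 * real d / real m))\<^sup>2" by (simp add: power_divide power_mult_distrib)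
    finally have "4 * \<bar>t j - of_int (round (t j))\<bar> \<le> 4 * (2 * real d / real m)"
      by (rule power2_le_imp_le) simp
    thus ?thesis by simp
  qed
  thus ?thesis using n(1) by (intro exI[of _ n] conjI exI[of _ "\<lambda>j. round (t j)"]) (auto simp: t_def algebra_simps)
qed

section \<open>Lattices, fill distance and separation radius\<close>

lemma vnorm_nonneg: "0 \<le> vnorm d x"
  by (simp add: vnorm_def sum_nonneg)

lemma vnorm_eq_L2_set: "vnorm d x = L2_set x {..<d}"
  by (simp add: vnorm_def L2_set_def)

lemma abs_le_vnorm: "j < d \<Longrightarrow> \<bar>x j\<bar> \<le> vnorm d x"
  using member_le_L2_set[of "{..<d}" j "\<lambda>j. \<bar>x j\<bar>"] by (simp add: vnorm_eq_L2_set L2_set_def)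

lemma vnorm_le:
  assumes "\<And>j. j < d \<Longrightarrow> \<bar>x j\<bar> \<le> c"
  shows "vnorm d x \<le> real d * c"
proof -
  have "vnorm d x \<le> (\<Sum>j<d. \<bar>x j\<bar>)" unfolding vnorm_eq_L2_set by (rule L2_set_le_sum_abs)
  also have "\<dots> \<le> (\<Sum>j<d. c)" by (rule sum_mono) (use assms in auto)
  finally show ?thesis by simp
qed

lemma sum_abs_le_vnorm: "(\<Sum>j<d. \<bar>x j\<bar>) \<le> real d * vnorm d x"
proof -
  have "(\<Sum>j<d. \<bar>x j\<bar>) \<le> (\<Sum>j<d. vnorm d x)" by (intro sum_mono abs_le_vnorm) auto
  thus ?thesis by simp
qed

lemma lambda1_le: "x \<in> L \<Longrightarrow> x \<noteq> (\<lambda>_. 0) \<Longrightarrow> lambda1 d L \<le> vnorm d x"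
  unfolding lambda1_def by (rule cInf_lower) (auto intro!: bdd_belowI[of _ 0] vnorm_nonneg)

text \<open>The witness \<open>x0\<close> rules out the infimum of the empty set.\<close>

lemma lambda1_ge:
  assumes "x0 \<in> L" "x0 \<noteq> (\<lambda>_. 0)" "\<And>x. x \<in> L \<Longrightarrow> x \<noteq> (\<lambda>_. 0) \<Longrightarrow> c \<le> vnorm d x"
  shows "c \<le> lambda1 d L"
  unfolding lambda1_def by (rule cInf_greatest) (use assms in auto)

section \<open>Dual lattices and first minima\<close>

lemma dual_lattice_rank1I:
  assumes N: "N \<ge> 1" and y: "y \<in> vec_space d" "\<And>j. j < d \<Longrightarrow> y j = of_int (h j)"
    and dv: "int N dvd (\<Sum>j<d. h j * z j)"
  shows "y \<in> dual_lattice d (rank1_lattice d N z)"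
  unfolding dual_lattice_def
proof (intro CollectI conjI ballI y(1))
  fix x assume "x \<in> rank1_lattice d N z"
  then obtain n :: int and k :: "nat \<Rightarrow> int" where
    x: "\<And>j. j < d \<Longrightarrow> x j = of_int n * of_int (z j) / real N + of_int (k j)"
    unfolding rank1_lattice_def by auto
  obtain c where c: "(\<Sum>j<d. h j * z j) = int N * c" using dv by auto
  have "(\<Sum>j<d. x j * y j) = (\<Sum>j<d. of_int n / real N * of_int (h j * z j) + of_int (k j * h j))"
    by (rule sum.cong) (auto simp: x y algebra_simps)
  also have "\<dots> = of_int n / real N * of_int (\<Sum>j<d. h j * z j) + of_int (\<Sum>j<d. k j * h j)"
    by (simp only: sum.distrib of_int_sum sum_distrib_left)
  also have "\<dots> = of_int (n * c + (\<Sum>j<d. k j * h j))" unfolding c using N by simp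
  finally show "(\<Sum>j<d. x j * y j) \<in> \<int>" by (simp only: Ints_of_int)
qed

text \<open>Pairing with unit vectors forces integer coordinates; pairing with the generator
  \<open>z / N\<close> forces the congruence.\<close>

lemma dual_lattice_rank1D:
  assumes N: "N \<ge> 1" and y: "y \<in> dual_lattice d (rank1_lattice d N z)"
  shows "\<exists>h. (\<forall>j<d. y j = of_int (h j)) \<and> int N dvd (\<Sum>j<d. h j * z j)"
proof -
  have yI: "(\<Sum>j<d. x j * y j) \<in> \<int>" if "x \<in> rank1_lattice d N z" for x
    using y that by (auto simp: dual_lattice_def)
  have "y j \<in> \<int>" if j: "j < d" for j
  proof -
    have "(\<lambda>i. if i = j then 1 else 0) \<in> rank1_lattice d N z"
      using j by (auto simp: rank1_lattice_def vec_space_def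
          intro!: exI[of _ 0] exI[of _ "\<lambda>i. if i = j then 1 else 0"])
    from yI[OF this] have "(\<Sum>i<d. (if i = j then 1 else 0) * y i) \<in> \<int>" .
    also have "(\<Sum>i<d. (if i = j then 1 else 0) * y i) = (\<Sum>i<d. if i = j then y i else 0)"
      by (rule sum.cong) auto
    also have "\<dots> = y j" using j by simp
    finally show ?thesis .
  qed
  hence "\<forall>j<d. \<exists>h. y j = of_int h" by (auto elim!: Ints_cases)
  then obtain h where h: "\<And>j. j < d \<Longrightarrow> y j = of_int (h j)" by metis
  have "(\<lambda>j. if j < d then of_int (z j) / real N else 0) \<in> rank1_lattice d N z"
    by (auto simp: rank1_lattice_def vec_space_def intro!: exI[of _ 1] exI[of _ "\<lambda>_. 0"])
  from yI[OF this] obtain c where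
    "(\<Sum>j<d. (if j < d then of_int (z j) / real N else 0) * y j) = of_int c" by (auto elim: Ints_cases)
  also have "(\<Sum>j<d. (if j < d then of_int (z j) / real N else 0) * y j) = (\<Sum>j<d. of_int (h j * z j) / real N)"
    by (rule sum.cong) (auto simp: h)
  also have "\<dots> = of_int (\<Sum>j<d. h j * z j) / real N" by (simp add: sum_divide_distrib)
  finally have "real_of_int (\<Sum>j<d. h j * z j) = of_int (c * int N)" using N by (simp add: field_simps)
  hence "(\<Sum>j<d. h j * z j) = c * int N" by (simp only: of_int_eq_iff)
  thus ?thesis using h by auto
qed

lemma lambda1_dual_ge:
  assumes d: "d \<ge> 1" and N: "N \<ge> 1"
    and dual: "\<And>h. dual_coeffs d N z h \<Longrightarrow> \<exists>j<d. \<bar>h j\<bar> \<ge> int M"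
  shows "real M \<le> lambda1 d (dual_lattice d (rank1_lattice d N z))"
proof (rule lambda1_ge)
  \<comment> \<open>\<open>N\<close> times the first unit vector is always dual and provides the
    witness.\<close>
  define y where "y = (\<lambda>j::nat. if j = 0 then real N else 0)"
  show "y \<in> dual_lattice d (rank1_lattice d N z)"
  proof (rule dual_lattice_rank1I[OF N])
    show "int N dvd (\<Sum>j<d. (if j = 0 then int N else 0) * z j)" by (intro dvd_sum) auto
  qed (use d in \<open>auto simp: y_def vec_space_def\<close>)
  have "y 0 \<noteq> 0" using N by (simp add: y_def)
  thus "y \<noteq> (\<lambda>_. 0)" by metis
next
  fix y assume y: "y \<in> dual_lattice d (rank1_lattice d N z)" "y \<noteq> (\<lambda>_. 0)"
  obtain h where h: "\<And>j. j < d \<Longrightarrow> y j = of_int (h j)" "int N dvd (\<Sum>j<d. h j * z j)"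
    using dual_lattice_rank1D[OF N y(1)] by blast
  have "y j = 0" if "j \<ge> d" for j using y(1) that by (auto simp: dual_lattice_def vec_space_def)
  then obtain i where "i < d" "y i \<noteq> 0" using y(2) by (metis ext not_le)
  hence "dual_coeffs d N z h" using h by (auto simp: dual_coeffs_def)
  then obtain j where j: "j < d" "\<bar>h j\<bar> \<ge> int M" using dual by blast
  have "real M = of_int (int M)" by simp
  also have "\<dots> \<le> of_int \<bar>h j\<bar>" using j(2) by (simp only: of_int_le_iff)
  also have "\<dots> = \<bar>y j\<bar>" using h(1)[OF j(1)] by simp
  also have "\<dots> \<le> vnorm d y" by (rule abs_le_vnorm[OF j(1)])
  finally show "real M \<le> vnorm d y" .
qed

text \<open>Scaling by \<open>N\<close> turns a lattice vector into an integer vector congruent to a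
  multiple of \<open>z\<close>, to which \<open>primal\<close> applies. Passing from the sum of
  absolute values to the Euclidean norm costs the factor \<open>d\<close>.\<close>

lemma lambda1_rank1_lattice_ge:
  assumes d: "d \<ge> 1" and N: "N \<ge> 1" and X: "X > 0"
    and primal: "\<And>w n. \<exists>j<d. w j \<noteq> 0 \<Longrightarrow> (\<And>j. j < d \<Longrightarrow> int N dvd w j - n * z j) \<Longrightarrow>
        int N \<le> int X * (\<Sum>j<d. \<bar>w j\<bar>)"
  shows "1 / (real d * real X) \<le> lambda1 d (rank1_lattice d N z)"
proof (rule lambda1_ge)
  define y where "y = (\<lambda>j::nat. if j = 0 then 1 else 0 :: real)"
  show "y \<in> rank1_lattice d N z"
    using d by (auto simp: rank1_lattice_def vec_space_def y_def
          intro!: exI[of _ 0] exI[of _ "\<lambda>i. if i = 0 then 1 else 0"])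
  have "y 0 \<noteq> 0" by (simp add: y_def)
  thus "y \<noteq> (\<lambda>_. 0)" by metis
next
  fix x assume x: "x \<in> rank1_lattice d N z" "x \<noteq> (\<lambda>_. 0)"
  obtain n :: int and k :: "nat \<Rightarrow> int" where
    xj: "\<And>j. j < d \<Longrightarrow> x j = of_int n * of_int (z j) / real N + of_int (k j)"
    using x(1) unfolding rank1_lattice_def by auto
  have "x j = 0" if "j \<ge> d" for j using x(1) that by (auto simp: rank1_lattice_def vec_space_def)
  then obtain i where i: "i < d" "x i \<noteq> 0" using x(2) by (metis ext not_le)
  define w where "w = (\<lambda>j. n * z j + int N * k j)"
  have xw: "of_int (w j) = real N * x j" if "j < d" for j
    using N xj[OF that] by (simp add: w_def field_simps)
  have "w i \<noteq> 0" using xw[OF i(1)] i N by auto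
  hence "int N \<le> int X * (\<Sum>j<d. \<bar>w j\<bar>)" using i by (intro primal[of _ n]) (auto simp: w_def)
  hence "real_of_int (int N) \<le> of_int (int X * (\<Sum>j<d. \<bar>w j\<bar>))" by (simp only: of_int_le_iff)
  also have "\<dots> = real X * (\<Sum>j<d. \<bar>of_int (w j)\<bar>)" by simp
  also have "(\<Sum>j<d. \<bar>of_int (w j)\<bar>) = (\<Sum>j<d. real N * \<bar>x j\<bar>)"
    by (rule sum.cong) (auto simp: xw abs_mult)
  also have "\<dots> = real N * (\<Sum>j<d. \<bar>x j\<bar>)" by (simp add: sum_distrib_left)
  also have "real X * (real N * (\<Sum>j<d. \<bar>x j\<bar>)) \<le> real X * (real N * (real d * vnorm d x))"
    by (intro mult_left_mono sum_abs_le_vnorm) auto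
  finally have "real N * 1 \<le> real N * (real d * real X * vnorm d x)" by (simp add: mult_ac)
  hence "1 \<le> real d * real X * vnorm d x" using N by (subst (asm) mult_le_cancel_left_pos) auto
  thus "1 / (real d * real X) \<le> vnorm d x" using d X by (simp add: divide_le_eq mult_ac)
qed

text \<open>With \<open>M\<close> least such that the count in \<open>exists_good_base\<close>
  fails, \<open>M - 1\<close> is still admissible and \<open>N\<close> is at most a constant times
  \<open>M ^ d\<close>. The lower bounds \<open>M\<close> and \<open>1 / (d * C * M)\<close> for the
  two minima multiply to a constant.\<close>

lemma exists_korobov_lambda1_product_ge:
  assumes N: "prime N" and d: "d \<ge> 1"
  shows "\<exists>b\<in>{1..<N}. 1 / (real d * real (d * 3 ^ d * d ^ (d - 1) + 1)) \<le>
      lambda1 d (rank1_lattice d N (korobov_z N b)) *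
      lambda1 d (dual_lattice d (rank1_lattice d N (korobov_z N b)))"
proof -
  have N1: "N \<ge> 1" using prime_ge_1_nat[OF N] .
  \<comment> \<open>The requirement \<open>M \<ge> 1\<close> is needed for
    \<open>primal_vector_bound\<close>; at \<open>M = 1\<close> the radius \<open>M - 1\<close>
    falls under \<open>R = 0\<close>.\<close>
  define P where "P = (\<lambda>M. M \<ge> 1 \<and> N < d * (2 * M + 1) ^ d)"
  define M where "M = (LEAST M. P M)"
  have "N < 1 * (2 * N + 1) ^ 1" by simp
  also have "\<dots> \<le> d * (2 * N + 1) ^ d" using d by (intro mult_mono power_increasing) auto
  finally have "P N" using N1 by (simp add: P_def)
  hence PM: "P M" unfolding M_def by (rule LeastI)
  hence M1: "M \<ge> 1" and NM: "N < d * (2 * M + 1) ^ d" by (auto simp: P_def)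
  have "\<not> P (M - 1)" unfolding M_def by (rule not_less_Least) (use M1 in \<open>simp add: M_def\<close>)
  hence R: "M - 1 = 0 \<or> d * (2 * (M - 1) + 1) ^ d \<le> N" unfolding P_def by linarith
  obtain b where b: "b \<in> {1..<N}"
    and bd: "\<And>h. dual_coeffs d N (\<lambda>j. int (b ^ j)) h \<Longrightarrow> \<exists>j<d. \<bar>h j\<bar> > int (M - 1)"
    using exists_good_base[OF N d R] by blast
  let ?z = "korobov_z N b"
  have dual: "\<exists>j<d. \<bar>h j\<bar> \<ge> int M" if h: "dual_coeffs d N ?z h" for h
  proof -
    have "dual_coeffs d N (\<lambda>j. int (b ^ j)) h"
      using h sum_mod_cong_dvd[of d N ?z "\<lambda>j. int (b ^ j)" h] pow_mod_diff_dvd[of N b]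
      by (simp add: dual_coeffs_def korobov_z_def)
    then obtain j where "j < d" "\<bar>h j\<bar> > int (M - 1)" using bd by blast
    thus ?thesis using M1 by (intro exI[of _ j]) auto
  qed
  have "N \<le> d * (2 * M + 1) ^ d" using NM by simp
  also have "\<dots> \<le> d * (3 * M) ^ d" using M1 by (intro mult_left_mono power_mono) auto
  also have "\<dots> = d * 3 ^ d * M ^ d" by (simp add: power_mult_distrib)
  finally have NK: "N \<le> d * 3 ^ d * M ^ d" .
  define C where "C = d * 3 ^ d * d ^ (d - 1) + 1"
  have "1 / (real d * real (C * M)) \<le> lambda1 d (rank1_lattice d N ?z)"
  proof (rule lambda1_rank1_lattice_ge[OF d N1])
    show "C * M > 0" using M1 by (simp add: C_def)
  next
    fix w :: "nat \<Rightarrow> int" and n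
    assume w: "\<exists>j<d. w j \<noteq> 0" "\<And>j. j < d \<Longrightarrow> int N dvd w j - n * ?z j"
    show "int N \<le> int (C * M) * (\<Sum>j<d. \<bar>w j\<bar>)"
      unfolding C_def
      by (rule primal_vector_bound[where z = ?z and n = n, OF d M1 N1 NK]) (fact dual w)+
  qed
  moreover have "real M \<le> lambda1 d (dual_lattice d (rank1_lattice d N ?z))"
    by (rule lambda1_dual_ge[OF d N1 dual])
  ultimately have "1 / (real d * real (C * M)) * real M \<le>
      lambda1 d (rank1_lattice d N ?z) * lambda1 d (dual_lattice d (rank1_lattice d N ?z))"
    by (intro mult_mono) (auto intro: order_trans[rotated])
  moreover have "1 / (real d * real (C * M)) * real M = 1 / (real d * real C)" using M1 by simp
  ultimately show ?thesis using b unfolding C_def by metis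
qed

section \<open>Fill distance and separation radius of the point sets\<close>

lemma fill_dist_le_of_near:
  assumes N: "N \<ge> 1" and r: "r > 0"
    and near: "\<And>x::nat \<Rightarrow> real. \<exists>n<N. \<exists>k::nat \<Rightarrow> int. \<forall>j<d. \<bar>x j - (real n * of_int (z j) / real N + of_int (k j))\<bar> \<le> r"
  shows "fill_dist d (rank1_pts d N z) \<le> real d * (4 * r)"
proof -
  define pt where "pt = (\<lambda>n j. if j < d then frac (real n * of_int (z j) / real N) else 0)"
  have pt: "pt n \<in> rank1_pts d N z" if "n < N" for n
    using that by (auto simp: pt_def rank1_pts_def vec_space_def)
  have ne: "unit_cube d \<noteq> {}" by (auto simp: unit_cube_def vec_space_def intro!: exI[of _ "\<lambda>_. 0"])
  have "(INF y\<in>rank1_pts d N z. vdist d x y) \<le> real d * (4 * r)" if x: "x \<in> unit_cube d" for x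
  proof -
    have le: "(INF y\<in>rank1_pts d N z. vdist d x y) \<le> vdist d x (pt n)" if "n < N" for n
      by (rule cINF_lower) (use pt[OF that] in \<open>auto intro!: bdd_belowI[of _ 0] simp: vdist_def vnorm_nonneg\<close>)
    have x01: "0 \<le> x j" "x j \<le> 1" if "j < d" for j using x that by (auto simp: unit_cube_def)
    show ?thesis
    \<comment> \<open>For large \<open>r\<close> the origin, which is \<open>pt 0\<close>, is
      already close enough.\<close>
    proof (cases "r > 1 / 4")
      case True
      have "vdist d x (pt 0) \<le> real d * (4 * r)" unfolding vdist_def
      proof (rule vnorm_le)
        fix j assume "j < d"
        thus "\<bar>x j - pt 0 j\<bar> \<le> 4 * r" using True x01[of j] by (simp add: pt_def)
      qed
      thus ?thesis using le[of 0] N by simp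
    next
      case False
      \<comment> \<open>Moving \<open>x\<close> into the interior keeps the nearby lattice point inside the unit cube.\<close>
      define x' where "x' = (\<lambda>j. max (2 * r) (min (1 - 2 * r) (x j)))"
      obtain n k where n: "n < N" and
        k: "\<And>j. j < d \<Longrightarrow> \<bar>x' j - (real n * of_int (z j) / real N + of_int (k j :: int))\<bar> \<le> r"
        using near[of x'] by blast
      have "vdist d x (pt n) \<le> real d * (4 * r)" unfolding vdist_def
      proof (rule vnorm_le)
        fix j assume j: "j < d"
        define p where "p = real n * of_int (z j) / real N + of_int (k j)"
        have xp: "\<bar>x' j - p\<bar> \<le> r" using k[OF j] by (simp add: p_def)
        have x': "2 * r \<le> x' j" "x' j \<le> 1 - 2 * r" "\<bar>x j - x' j\<bar> \<le> 2 * r"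
          using False x01[OF j] r by (auto simp: x'_def)
        have "p \<ge> 0" "p < 1" using x' xp r by linarith+
        hence "frac (real n * of_int (z j) / real N) = p"
          by (subst frac_unique_iff) (simp add: p_def)
        hence "pt n j = p" using j by (simp add: pt_def)
        thus "\<bar>x j - pt n j\<bar> \<le> 4 * r" using xp x' r by linarith
      qed
      thus ?thesis using le[OF n] by simp
    qed
  qed
  thus ?thesis unfolding fill_dist_def by (intro cSUP_least ne)
qed

text \<open>A dual vector with all entries at most \<open>m < B / d\<close> in absolute value would
  be shorter than \<open>B\<close>, so the Fourier bound applies with \<open>m\<close> just below
  \<open>B / d\<close>, provided \<open>m \<ge> 2\<close>.\<close>

lemma fill_dist_le_dual:
  assumes d: "d \<ge> 1" and N: "N \<ge> 1"
    and B: "B = lambda1 d (dual_lattice d (rank1_lattice d N z))" "B > 0"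
  shows "fill_dist d (rank1_pts d N z) \<le> 12 * real d ^ 3 / B"
proof (cases "B \<le> 3 * real d")
  case True
  \<comment> \<open>For small \<open>B\<close> the integer points alone, with \<open>n = 0\<close>,
    suffice.\<close>
  have "fill_dist d (rank1_pts d N z) \<le> real d * (4 * (1 / 2))"
  proof (rule fill_dist_le_of_near[OF N])
    fix x :: "nat \<Rightarrow> real"
    show "\<exists>n<N. \<exists>k::nat \<Rightarrow> int. \<forall>j<d. \<bar>x j - (real n * of_int (z j) / real N + of_int (k j))\<bar> \<le> 1 / 2"
      using N of_int_round_abs_le
      by (intro exI[of _ 0] conjI exI[of _ "\<lambda>j. round (x j)"]) (auto simp: abs_minus_commute)
  qed simp
  also have "\<dots> = 2 * real d * 1" by simp
  also have "\<dots> \<le> 2 * real d * (3 * real d / B)"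
    using True B by (intro mult_left_mono) (auto simp: le_divide_eq)
  also have "\<dots> = 6 * real d ^ 2 / B" by (simp add: power2_eq_square)
  also have "\<dots> \<le> 12 * real d ^ 3 / B"
  proof (intro divide_right_mono mult_mono power_increasing)
  qed (use d B in auto)
  finally show ?thesis .
next
  case False
  \<comment> \<open>The largest integer strictly below \<open>B / d\<close>.\<close>
  define m where "m = nat (\<lceil>B / real d\<rceil> - 1)"
  have Bd: "B / real d > 3" using False d by (simp add: less_divide_eq)
  have ge: "B / real d - 1 \<le> real m" and lt: "real m < B / real d"
    using Bd unfolding m_def by linarith+
  have m: "m \<ge> 2" using ge Bd by linarith
  have nd: "\<exists>j<d. \<bar>h j\<bar> > int m" if h: "dual_coeffs d N z h" for h
  proof (rule ccontr)
    assume neg: "\<not> ?thesis"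
    define y where "y = (\<lambda>j. if j < d then real_of_int (h j) else 0)"
    have "y \<in> dual_lattice d (rank1_lattice d N z)"
      by (rule dual_lattice_rank1I[OF N, where h = h]) (use h in \<open>auto simp: y_def vec_space_def dual_coeffs_def\<close>)
    moreover have "y \<noteq> (\<lambda>_. 0)" 
    proof -
      obtain i where "i < d" "h i \<noteq> 0" using h by (auto simp: dual_coeffs_def)
      hence "y i \<noteq> 0" by (simp add: y_def)
      thus ?thesis by metis
    qed
    ultimately have "B \<le> vnorm d y" unfolding B(1) by (rule lambda1_le)
    also have "\<dots> \<le> real d * real m"
    proof (rule vnorm_le)
      fix j assume j: "j < d"
      hence "\<bar>h j\<bar> \<le> int m" using neg by (meson not_less)
      hence "real_of_int \<bar>h j\<bar> \<le> of_int (int m)" by (simp only: of_int_le_iff)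
      thus "\<bar>y j\<bar> \<le> real m" using j by (simp add: y_def)
    qed
    also have "\<dots> < B" using lt d by (simp add: field_simps)
    finally show False by simp
  qed
  have "fill_dist d (rank1_pts d N z) \<le> real d * (4 * (2 * real d / real m))"
    by (rule fill_dist_le_of_near[OF N _ exists_near_lattice_point[OF N m nd]]) (use d m in auto)
  also have "\<dots> = 8 * real d ^ 2 / real m" by (simp add: power2_eq_square)
  also have "\<dots> \<le> 8 * real d ^ 2 / (2 / 3 * (B / real d))"
  proof (rule divide_left_mono)
    \<comment> \<open>Since \<open>B / d > 3\<close>, subtracting 1 costs at most a third; this
      turns 8 into 12.\<close>
    show "2 / 3 * (B / real d) \<le> real m" using ge Bd by linarith
    show "0 < real m * (2 / 3 * (B / real d))"
      using m Bd by (intro mult_pos_pos) linarith+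
  qed simp
  also have "\<dots> = 12 * real d ^ 3 / B" using d B(2) by (simp add: field_simps power2_eq_square power3_eq_cube)
  finally show ?thesis .
qed

lemma rank1_pts_eq_image:
  "rank1_pts d N z = (\<lambda>n j. if j < d then frac (real n * of_int (z j) / real N) else 0) ` {..<N}"
proof (intro equalityI subsetI)
  fix x assume x: "x \<in> rank1_pts d N z"
  then obtain n where n: "n < N" "\<forall>j<d. x j = frac (real n * of_int (z j) / real N)"
    by (auto simp: rank1_pts_def)
  moreover have "x j = 0" if "j \<ge> d" for j using x that by (auto simp: rank1_pts_def vec_space_def)
  ultimately have "x = (\<lambda>j. if j < d then frac (real n * of_int (z j) / real N) else 0)" by auto
  with n(1) show "x \<in> (\<lambda>n j. if j < d then frac (real n * of_int (z j) / real N) else 0) ` {..<N}" by blast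
qed (auto simp: rank1_pts_def vec_space_def)

text \<open>The first coordinates are the distinct numbers \<open>n / N\<close>.\<close>

lemma card_rank1_pts:
  assumes d: "d \<ge> 1" and z: "z 0 = 1"
  shows "card (rank1_pts d N z) = N"
proof -
  have "inj_on (\<lambda>n j. if j < d then frac (real n * of_int (z j) / real N) else 0) {..<N}"
  proof (rule inj_onI)
    fix n n' assume n: "n \<in> {..<N}" "n' \<in> {..<N}"
      and eq: "(\<lambda>j. if j < d then frac (real n * of_int (z j) / real N) else 0) =
               (\<lambda>j. if j < d then frac (real n' * of_int (z j) / real N) else 0)"
    have fr: "frac (real k / real N) = real k / real N" if "k < N" for k
      using that by (simp add: frac_eq)
    from fun_cong[OF eq, of 0] d z fr n show "n = n'" by auto
  qed
  thus ?thesis unfolding rank1_pts_eq_image by (simp add: card_image)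
qed

lemma rank1_pts_subset_unit_cube: "rank1_pts d N z \<subseteq> unit_cube d"
  by (auto simp: rank1_pts_def unit_cube_def frac_lt_1 less_imp_le)

text \<open>Fractional parts change coordinates by integers, so the difference of two distinct
  points is a nonzero lattice vector.\<close>

lemma lambda1_le_sep_radius:
  assumes "card (rank1_pts d N z) \<ge> 2"
  shows "lambda1 d (rank1_lattice d N z) / 2 \<le> sep_radius d (rank1_pts d N z)"
proof -
  let ?P = "rank1_pts d N z"
  obtain x0 y0 where xy0: "x0 \<in> ?P" "y0 \<in> ?P" "x0 \<noteq> y0"
    using assms by (metis card_le_Suc0_iff_eq card.infinite not_less_eq_eq numeral_2_eq_2 zero_le)
  have "lambda1 d (rank1_lattice d N z) \<le> Inf {vdist d x y | x y. x \<in> ?P \<and> y \<in> ?P \<and> x \<noteq> y}"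
  proof (rule cInf_greatest)
    show "{vdist d x y | x y. x \<in> ?P \<and> y \<in> ?P \<and> x \<noteq> y} \<noteq> {}" using xy0 by blast
  next
    fix t assume "t \<in> {vdist d x y | x y. x \<in> ?P \<and> y \<in> ?P \<and> x \<noteq> y}"
    then obtain x y where t: "t = vdist d x y" and xy: "x \<in> ?P" "y \<in> ?P" "x \<noteq> y" by blast
    obtain n n' where n: "\<And>j. j < d \<Longrightarrow> x j = frac (real n * of_int (z j) / real N)"
      "\<And>j. j < d \<Longrightarrow> y j = frac (real n' * of_int (z j) / real N)"
      using xy by (auto simp: rank1_pts_def)
    have "(\<lambda>j. x j - y j) \<in> rank1_lattice d N z"
      unfolding rank1_lattice_def
    proof (intro CollectI conjI exI allI impI)
      show "(\<lambda>j. x j - y j) \<in> vec_space d" using xy by (auto simp: rank1_pts_def vec_space_def)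
      fix j assume j: "j < d"
      show "x j - y j = of_int (int n - int n') * of_int (z j) / real N +
          of_int (\<lfloor>real n' * of_int (z j) / real N\<rfloor> - \<lfloor>real n * of_int (z j) / real N\<rfloor>)"
        using n[OF j] by (simp add: frac_def left_diff_distrib diff_divide_distrib)
    qed
    moreover have "(\<lambda>j. x j - y j) \<noteq> (\<lambda>_. 0)" using xy(3) by (auto simp: fun_eq_iff)
    ultimately show "lambda1 d (rank1_lattice d N z) \<le> t" unfolding t vdist_def by (rule lambda1_le)
  qed
  thus ?thesis by (simp add: sep_radius_def)
qed

section \<open>Prime gaps and the final bound\<close>

text \<open>If \<open>2 ^ k\<close> is the power of two with
  \<open>2 ^ k \<le> nth_prime i < 2 ^ (k + 1)\<close>, some prime lies in
  \<open>(2 ^ (k + 1), 2 ^ (k + 7)]\<close>, whence \<open>128 = 2 ^ 7\<close>.\<close>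

lemma nth_prime_Suc_le: "nth_prime (Suc i) \<le> 128 * nth_prime i"
  and nth_prime_less_Suc: "nth_prime i < nth_prime (Suc i)"
  and prime_nth_prime: "prime (nth_prime i)"
proof -
  have inf: "infinite {p::nat. prime p}" by (rule primes_infinite)
  show "nth_prime i < nth_prime (Suc i)" unfolding nth_prime_def by (rule enumerate_step[OF inf])
  show pr: "prime (nth_prime i)" unfolding nth_prime_def using enumerate_in_set[OF inf, of i] by simp
  obtain k where k: "2 ^ k \<le> nth_prime i" "nth_prime i < 2 ^ Suc k"
    using ex_power_ivl1[of 2 "nth_prime i"] prime_gt_0_nat[OF pr] by auto
  obtain p where p: "prime p" "2 ^ Suc k < p" "p \<le> (2 ^ (Suc k + 6) :: nat)"
    using prime_between_powers_two by blast
  have "nth_prime (Suc i) \<le> p" unfolding nth_prime_def enumerate_Suc''[OF inf]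
    by (rule Least_le) (use p k in \<open>auto simp: nth_prime_def\<close>)
  also have "\<dots> \<le> 128 * 2 ^ k" using p(3) by (simp add: power_add)
  also have "\<dots> \<le> 128 * nth_prime i" using k by simp
  finally show "nth_prime (Suc i) \<le> 128 * nth_prime i" .
qed

theorem mainTheorem8:
  fixes d :: nat and a :: "nat \<Rightarrow> nat"
  assumes "d \<ge> 1"
    and "\<And>i. a i \<in> {1..<nth_prime i}"
    and "\<And>i b. b \<in> {1..<nth_prime i} \<Longrightarrow>
       lambda1 d (rank1_lattice d (nth_prime i) (korobov_z (nth_prime i) b)) *
       lambda1 d (dual_lattice d (rank1_lattice d (nth_prime i) (korobov_z (nth_prime i) b)))
       \<le> lambda1 d (rank1_lattice d (nth_prime i) (korobov_z (nth_prime i) (a i))) *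
         lambda1 d (dual_lattice d (rank1_lattice d (nth_prime i) (korobov_z (nth_prime i) (a i))))"
  shows "quasi_uniform d (\<lambda>i. rank1_pts d (nth_prime i) (korobov_z (nth_prime i) (a i)))"
proof -
  let ?P = "\<lambda>i. rank1_pts d (nth_prime i) (korobov_z (nth_prime i) (a i))"
  define c where "c = 1 / (real d * real (d * 3 ^ d * d ^ (d - 1) + 1))"
  have c: "c > 0" using assms(1) by (simp add: c_def add_pos_nonneg)
  have N2: "nth_prime i \<ge> 2" for i using prime_ge_2_nat[OF prime_nth_prime] .
  have cardP: "card (?P i) = nth_prime i" for i
    using N2[of i] by (intro card_rank1_pts assms(1)) (simp add: korobov_z_def)
  have mesh: "mesh_ratio d (?P i) \<le> 24 * real d ^ 3 / c" for i
  proof -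
    define A where "A = lambda1 d (rank1_lattice d (nth_prime i) (korobov_z (nth_prime i) (a i)))"
    define B where "B = lambda1 d (dual_lattice d (rank1_lattice d (nth_prime i) (korobov_z (nth_prime i) (a i))))"
    have N1: "nth_prime i \<ge> 1" using N2[of i] by simp
    \<comment> \<open>Maximality of \<open>a i\<close> passes the bound from the good parameter to
      \<open>a i\<close>.\<close>
    have AB: "c \<le> A * B" unfolding c_def A_def B_def
      using exists_korobov_lambda1_product_ge[OF prime_nth_prime assms(1), of i] assms(3)
      by (meson order_trans)
    \<comment> \<open>Nonzero integer vectors have norm at least 1; with \<open>AB\<close> this also
      makes \<open>A\<close> positive.\<close>
    have "real 1 \<le> B" unfolding B_def
      by (rule lambda1_dual_ge[OF assms(1) N1]) (auto simp: dual_coeffs_def)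
    hence B: "B > 0" by simp
    hence A: "A > 0" using AB c by (metis less_le_trans zero_less_mult_pos2)
    have fill: "fill_dist d (?P i) \<le> 12 * real d ^ 3 / B"
      by (rule fill_dist_le_dual[OF assms(1) N1 B_def B])
    have sep: "A / 2 \<le> sep_radius d (?P i)"
      unfolding A_def by (rule lambda1_le_sep_radius) (simp add: cardP N2)
    have "mesh_ratio d (?P i) \<le> (12 * real d ^ 3 / B) / sep_radius d (?P i)"
      unfolding mesh_ratio_def using fill sep A by (intro divide_right_mono) auto
    also have "\<dots> \<le> (12 * real d ^ 3 / B) / (A / 2)"
      using sep A B by (intro divide_left_mono) auto
    also have "\<dots> = 24 * real d ^ 3 / (A * B)" by simp
    also have "\<dots> \<le> 24 * real d ^ 3 / c" using AB c by (intro divide_left_mono) auto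
    finally show ?thesis .
  qed
  show ?thesis unfolding quasi_uniform_def
  proof (intro conjI allI)
    fix i
    show "finite (?P i)" by (simp add: rank1_pts_eq_image)
    show "?P i \<subseteq> unit_cube d" by (rule rank1_pts_subset_unit_cube)
    show "2 \<le> card (?P i)" by (simp add: cardP N2)
  next
    have "real (nth_prime (Suc i)) \<le> 128 * real (nth_prime i)" for i
      using nth_prime_Suc_le[of i] by linarith
    thus "\<exists>c::real. c > 1 \<and> (\<forall>i. card (?P i) < card (?P (Suc i)) \<and>
        real (card (?P (Suc i))) \<le> c * real (card (?P i)))"
      by (intro exI[of _ 128]) (simp add: cardP nth_prime_less_Suc)
  next
    show "\<exists>C::real. \<forall>i. mesh_ratio d (?P i) \<le> C" using mesh by blast
  qed
qed

end
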